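(* Assume $\lambda_0\ge0$, that $1/\alpha\in\mathrm{Dom}(\mathcal L)$, that $\phi_0\in\mathrm{Dom}(\mathcal L)$, and that there exist positive constants $C_1,C_2$ with $C_1\le\phi_0(x)\le C_2$ for all $x\in E$. Then the $(\mathcal L,\beta,\alpha)$-superprocess satisfies the global extinction property: $\mathbb P_\nu(H_{\max}<\infty)=1$ for all $\nu\in\mathcal M_f(E)$.
   Context: $C_b$ denotes the bounded continuous real functions on the state space $E$, $\mathcal M_f(E)$ the finite measures on $E$, $\nu(f)=\int f\,d\nu$. $Y$ is the canonical process on $D(\mathbb R_+,E)$ (càdlàg paths) and $(\mathrm P_x)_{x\in E}$ a Borel strong Markov process (expectation $\mathrm E_x$) whose semigroup maps $C_b$ to $C_b$. Its generator $\mathcal L$: $f\in\mathrm{Dom}(\mathcal L)$ iff $f\in C_b$ and there is $g\in C_b$ such that $f(Y_t)-f(x)-\int_0^tg(Y_s)ds$ is a $\mathrm P_x$-martingale for all $x$; then $\mathcal Lf=g$. Moreover $Y$ is either (a) an irreducible continuous-time Markov chain on a finite set $E=\{1,\dots,K\}$, or (b) a diffusion on a domain $E\subset\mathbb R^K$ with generator $\mathcal Lu=\sum_ib_i\partial_{x_i}u+\frac12\sum_{i,j}a_{ij}\partial_{x_ix_j}u$, where $a_{ij},b_i\in C^{1,\mu}(E)$ (first-order derivatives locally Hölder with exponent $\mu\in[0,1)$) and $(a_{ij})$ is positive definite. $\alpha,\beta\in C_b$, $\alpha$ bounded below by a positive constant, $\psi(x,\lambda)=\beta(x)\lambda+\alpha(x)\lambda^2$.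 The $(\mathcal L,\beta,\alpha)$-superprocess is the Markov process $X$ on $C(\mathbb R_+,\mathcal M_f(E))$ with laws $\mathbb P_\nu$, $\nu\in\mathcal M_f(E)$, such that for bounded nonnegative measurable $f,\phi$: $\mathbb E_\nu[e^{-X_t(f)-\int_0^tX_s(\phi)ds}]=e^{-\nu(u_t)}$, where $u\ge0$ is the unique jointly measurable solution, bounded on $[0,T]\times E$ for all $T$, of $u_t(x)+\mathrm E_x[\int_0^t\psi(Y_s,u_{t-s}(Y_s))ds]=\mathrm E_x[f(Y_t)+\int_0^t\phi(Y_s)ds]$. $H_{\max}=\inf\{t>0:X_t=0\}$. $\lambda_0=\sup\{\ell\in\mathbb R:\exists u\in\mathrm{Dom}(\mathcal L),u>0,(\beta-\mathcal L)u=\ell u\}$ is the generalized eigenvalue of $\beta-\mathcal L$; the space of positive harmonic functions of $(\beta-\lambda_0)-\mathcal L$ is assumed one-dimensional, and $\phi_0>0$ is a generator of it, so $(\beta-\mathcal L)\phi_0=\lambda_0\phi_0$. *)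

theory Defs
  imports "HOL-Probability.Probability"
begin

section \<open>Canonical Markov processes in continuous time\<close>

text \<open>Paths are functions on \<open>[0,\<infinity>)\<close>, represented as functions on \<^typ>\<open>real\<close> that are
  \<^const>\<open>undefined\<close> at negative times. \<open>S\<close> is the measurable state space and \<open>W\<close> the set of
  admissible paths.\<close>

definition path_algebra :: "'s measure \<Rightarrow> (real \<Rightarrow> 's) set \<Rightarrow> (real \<Rightarrow> 's) measure" where
  "path_algebra S W = restrict_space (Pi\<^sub>M {0..} (\<lambda>_. S)) W"

definition natural_filtration ::
    "'s measure \<Rightarrow> (real \<Rightarrow> 's) set \<Rightarrow> real \<Rightarrow> (real \<Rightarrow> 's) measure" where
  "natural_filtration S W t =
     vimage_algebra W (\<lambda>\<omega>. restrict \<omega> {0..t}) (Pi\<^sub>M {0..t} (\<lambda>_. S))"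

definition shift :: "real \<Rightarrow> (real \<Rightarrow> 's) \<Rightarrow> (real \<Rightarrow> 's)" where
  "shift s \<omega> = (\<lambda>t\<in>{0..}. \<omega> (s + t))"

text \<open>Membership in \<^const>\<open>prob_algebra\<close> says that \<open>x \<mapsto> P x A\<close> is measurable for every event \<open>A\<close>.\<close>

definition markov_family ::
    "'s measure \<Rightarrow> (real \<Rightarrow> 's) set \<Rightarrow> ('s \<Rightarrow> (real \<Rightarrow> 's) measure) \<Rightarrow> bool" where
  "markov_family S W P \<longleftrightarrow>
     P \<in> S \<rightarrow>\<^sub>M prob_algebra (path_algebra S W) \<and>
     (\<forall>x\<in>space S. AE \<omega> in P x. \<omega> 0 = x) \<and>
     (\<forall>x\<in>space S. \<forall>s\<ge>0. \<forall>B\<in>sets (natural_filtration S W s). \<forall>A\<in>sets (path_algebra S W).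
        emeasure (P x) {\<omega> \<in> B. shift s \<omega> \<in> A}
          = (\<integral>\<^sup>+\<omega>. emeasure (P (\<omega> s)) A * indicator B \<omega> \<partial>P x))"

text \<open>Only finite stopping times occur below. For a stopping time with values in \<open>[0,\<infinity>]\<close> the strong
  Markov property on \<open>{T < \<infinity>}\<close> follows by applying it to \<open>min T n\<close> on the events \<open>B \<inter> {T \<le> n}\<close>.\<close>

definition strong_markov_family ::
    "'s measure \<Rightarrow> (real \<Rightarrow> 's) set \<Rightarrow> ('s \<Rightarrow> (real \<Rightarrow> 's) measure) \<Rightarrow> bool" where
  "strong_markov_family S W P \<longleftrightarrow>
     markov_family S W P \<and>
     (\<forall>x\<in>space S. \<forall>T. stopping_time (natural_filtration S W) T \<and> (\<forall>\<omega>\<in>W. 0 \<le> T \<omega>) \<longrightarrow>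
        (\<forall>B\<in>sets (filtration.pre_sigma W (natural_filtration S W) T).
         \<forall>A\<in>sets (path_algebra S W).
           emeasure (P x) {\<omega> \<in> B. shift (T \<omega>) \<omega> \<in> A}
             = (\<integral>\<^sup>+\<omega>. emeasure (P (\<omega> (T \<omega>))) A * indicator B \<omega> \<partial>P x)))"

definition martingale ::
    "'w measure \<Rightarrow> (real \<Rightarrow> 'w measure) \<Rightarrow> (real \<Rightarrow> 'w \<Rightarrow> real) \<Rightarrow> bool" where
  "martingale M F Z \<longleftrightarrow>
     (\<forall>t\<ge>0. Z t \<in> borel_measurable (F t) \<and> integrable M (Z t)) \<and>
     (\<forall>s t. 0 \<le> s \<and> s \<le> t \<longrightarrow> (AE \<omega> in M. real_cond_exp M (F s) (Z t) \<omega> = Z s \<omega>))"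


section \<open>The spatial motion\<close>

text \<open>The state space \<open>E\<close> is a subset of a topological space with the subspace topology.
  Functions on \<open>E\<close> are total functions of which only the values on \<open>E\<close> matter.\<close>

abbreviation borel_on :: "'a::topological_space set \<Rightarrow> 'a measure" where
  "borel_on E \<equiv> restrict_space borel E"

definition Cb :: "'a::topological_space set \<Rightarrow> ('a \<Rightarrow> real) set" where
  "Cb E = {f. continuous_on E f \<and> bounded (f ` E)}"

text \<open>The trace of the product \<open>\<sigma>\<close>-algebra on the cadlag paths is the Borel \<open>\<sigma>\<close>-algebra of the
  Skorokhod topology.\<close>

definition cadlag_paths :: "'a::topological_space set \<Rightarrow> (real \<Rightarrow> 'a) set" where
  "cadlag_paths E = {\<omega> \<in> {0..} \<rightarrow>\<^sub>E E.
     (\<forall>t\<ge>0. (\<omega> \<longlongrightarrow> \<omega> t) (at_right t)) \<and>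
     (\<forall>t>0. \<exists>l\<in>E. (\<omega> \<longlongrightarrow> l) (at_left t))}"

definition Cb_semigroup ::
    "'a::topological_space set \<Rightarrow> ('a \<Rightarrow> (real \<Rightarrow> 'a) measure) \<Rightarrow> bool" where
  "Cb_semigroup E P \<longleftrightarrow> (\<forall>t\<ge>0. \<forall>f\<in>Cb E. (\<lambda>x. \<integral>\<omega>. f (\<omega> t) \<partial>P x) \<in> Cb E)"

definition solves_martingale_problem ::
    "'a::topological_space set \<Rightarrow> ('a \<Rightarrow> (real \<Rightarrow> 'a) measure) \<Rightarrow>
     ('a \<Rightarrow> real) \<Rightarrow> ('a \<Rightarrow> real) \<Rightarrow> bool" where
  "solves_martingale_problem E P f g \<longleftrightarrow>
     (\<forall>x\<in>E. martingale (P x) (natural_filtration (borel_on E) (cadlag_paths E))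
        (\<lambda>t \<omega>. f (\<omega> t) - f x - (LINT s:{0..t}|lborel. g (\<omega> s))))"

definition Dom :: "'a::topological_space set \<Rightarrow> ('a \<Rightarrow> (real \<Rightarrow> 'a) measure) \<Rightarrow> ('a \<Rightarrow> real) set" where
  "Dom E P = {f \<in> Cb E. \<exists>g\<in>Cb E. solves_martingale_problem E P f g}"

text \<open>The function \<open>g\<close> is determined on \<open>E\<close>, by right-continuity of the paths; its values off \<open>E\<close>
  are arbitrary, whence the choice operator.\<close>

definition generator ::
    "'a::topological_space set \<Rightarrow> ('a \<Rightarrow> (real \<Rightarrow> 'a) measure) \<Rightarrow> ('a \<Rightarrow> real) \<Rightarrow> 'a \<Rightarrow> real" where
  "generator E P f = (SOME g. g \<in> Cb E \<and> solves_martingale_problem E P f g)"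

text \<open>A cadlag Markov process on a finite discrete space is a continuous-time Markov chain, so
  only irreducibility has to be required. The states are arbitrary points; their labels play no
  role.\<close>

definition irreducible_finite_chain ::
    "'a::topological_space set \<Rightarrow> ('a \<Rightarrow> (real \<Rightarrow> 'a) measure) \<Rightarrow> bool" where
  "irreducible_finite_chain E P \<longleftrightarrow>
     finite E \<and> E \<noteq> {} \<and>
     (\<forall>x\<in>E. \<forall>y\<in>E. \<exists>t\<ge>0. measure (P x) {\<omega> \<in> space (P x). \<omega> t = y} > 0)"

definition partial :: "'k::finite \<Rightarrow> (real^'k \<Rightarrow> real) \<Rightarrow> real^'k \<Rightarrow> real" where
  "partial i u x = frechet_derivative u (at x) (axis i 1)"

text \<open>For open \<open>E\<close>.\<close>

definition C1_on :: "(real^'k) set \<Rightarrow> (real^'k::finite \<Rightarrow> real) \<Rightarrow> bool" where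
  "C1_on E u \<longleftrightarrow> u differentiable_on E \<and> (\<forall>i. continuous_on E (partial i u))"

definition C2_on :: "(real^'k) set \<Rightarrow> (real^'k::finite \<Rightarrow> real) \<Rightarrow> bool" where
  "C2_on E u \<longleftrightarrow> C1_on E u \<and> (\<forall>i. C1_on E (partial i u))"

definition locally_Hoelder_on :: "'a::metric_space set \<Rightarrow> real \<Rightarrow> ('a \<Rightarrow> real) \<Rightarrow> bool" where
  "locally_Hoelder_on E \<mu> f \<longleftrightarrow>
     (\<forall>x\<in>E. \<exists>r>0. \<exists>C. \<forall>y\<in>ball x r \<inter> E. \<forall>z\<in>ball x r \<inter> E. \<bar>f y - f z\<bar> \<le> C * dist y z powr \<mu>)"

definition C1_Hoelder_on :: "(real^'k) set \<Rightarrow> real \<Rightarrow> (real^'k::finite \<Rightarrow> real) \<Rightarrow> bool" where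
  "C1_Hoelder_on E \<mu> f \<longleftrightarrow> C1_on E f \<and> (\<forall>i. locally_Hoelder_on E \<mu> (partial i f))"

definition positive_definite :: "real^'k^'k \<Rightarrow> bool" where
  "positive_definite A \<longleftrightarrow> transpose A = A \<and> (\<forall>v. v \<noteq> 0 \<longrightarrow> v \<bullet> (A *v v) > 0)"

definition diffusion_operator ::
    "(real^'k \<Rightarrow> real^'k^'k) \<Rightarrow> (real^'k \<Rightarrow> real^'k) \<Rightarrow> (real^'k::finite \<Rightarrow> real) \<Rightarrow> real^'k \<Rightarrow> real" where
  "diffusion_operator a b u x =
     (\<Sum>i\<in>UNIV. b x $ i * partial i u x)
     + 1/2 * (\<Sum>i\<in>UNIV. \<Sum>j\<in>UNIV. a x $ i $ j * partial i (partial j u) x)"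

text \<open>A diffusion on \<open>E\<close> with this operator is a continuous process in \<open>E\<close> that solves the
  martingale problem for the compactly supported \<open>C\<^sup>2\<close> functions. It is conservative because the
  paths stay in \<open>E\<close>.\<close>

definition diffusion ::
    "(real^'k) set \<Rightarrow> (real^'k \<Rightarrow> (real \<Rightarrow> real^'k) measure) \<Rightarrow> real \<Rightarrow>
     (real^'k \<Rightarrow> real^'k^'k) \<Rightarrow> (real^'k::finite \<Rightarrow> real^'k) \<Rightarrow> bool" where
  "diffusion E P \<mu> a b \<longleftrightarrow>
     open E \<and> connected E \<and> E \<noteq> {} \<and>
     0 \<le> \<mu> \<and> \<mu> < 1 \<and>
     (\<forall>i j. C1_Hoelder_on E \<mu> (\<lambda>x. a x $ i $ j)) \<and>
     (\<forall>i. C1_Hoelder_on E \<mu> (\<lambda>x. b x $ i)) \<and>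
     (\<forall>x\<in>E. positive_definite (a x)) \<and>
     (\<forall>x\<in>E. AE \<omega> in P x. continuous_on {0..} \<omega>) \<and>
     (\<forall>u. C2_on E u \<and> (\<exists>K. compact K \<and> K \<subseteq> E \<and> (\<forall>x\<in>E - K. u x = 0)) \<longrightarrow>
        u \<in> Dom E P \<and> (\<forall>x\<in>E. generator E P u x = diffusion_operator a b u x))"


section \<open>The superprocess\<close>

text \<open>\<open>M\<^sub>f(E)\<close> is defined as \<^const>\<open>subprob_algebra\<close> is, with the \<open>\<sigma>\<close>-algebra generated by the
  evaluations \<open>\<nu> \<mapsto> \<nu>(A)\<close>. For the state spaces considered here this is the Borel \<open>\<sigma>\<close>-algebra of
  the weak topology.\<close>

definition finite_measure_algebra :: "'a measure \<Rightarrow> 'a measure measure" where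
  "finite_measure_algebra N =
     (SUP A\<in>sets N. vimage_algebra {M. finite_measure M \<and> sets M = sets N} (\<lambda>M. emeasure M A) borel)"

definition finite_measures :: "'a::topological_space set \<Rightarrow> 'a measure set" where
  "finite_measures E = {\<nu>. finite_measure \<nu> \<and> sets \<nu> = sets (borel_on E)}"

definition weak_topology :: "'a::topological_space set \<Rightarrow> 'a measure topology" where
  "weak_topology E = topology_generated_by
     {{\<nu> \<in> finite_measures E. (\<integral>x. f x \<partial>\<nu>) \<in> U} | f U. f \<in> Cb E \<and> open U}"

definition continuous_measure_paths :: "'a::topological_space set \<Rightarrow> (real \<Rightarrow> 'a measure) set" where
  "continuous_measure_paths E =
     {X \<in> extensional {0..}. continuous_map (top_of_set {0..}) (weak_topology E) X}"

definition \<psi> :: "('a \<Rightarrow> real) \<Rightarrow> ('a \<Rightarrow> real) \<Rightarrow> 'a \<Rightarrow> real \<Rightarrow> real" where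
  "\<psi> \<beta> \<alpha> x l = \<beta> x * l + \<alpha> x * l\<^sup>2"

definition bounded_nonneg_measurable :: "'a::topological_space set \<Rightarrow> ('a \<Rightarrow> real) set" where
  "bounded_nonneg_measurable E =
     {f \<in> borel_measurable (borel_on E). bounded (f ` E) \<and> (\<forall>x\<in>E. 0 \<le> f x)}"

definition cumulant_solution ::
    "'a::topological_space set \<Rightarrow> ('a \<Rightarrow> (real \<Rightarrow> 'a) measure) \<Rightarrow> ('a \<Rightarrow> real) \<Rightarrow> ('a \<Rightarrow> real) \<Rightarrow>
     ('a \<Rightarrow> real) \<Rightarrow> ('a \<Rightarrow> real) \<Rightarrow> (real \<Rightarrow> 'a \<Rightarrow> real) \<Rightarrow> bool" where
  "cumulant_solution E P \<beta> \<alpha> f \<phi> u \<longleftrightarrow>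
     (\<lambda>(t, x). u t x) \<in> borel_measurable (borel_on {0..} \<Otimes>\<^sub>M borel_on E) \<and>
     (\<forall>t\<ge>0. \<forall>x\<in>E. 0 \<le> u t x) \<and>
     (\<forall>T. bounded ((\<lambda>(t, x). u t x) ` ({0..T} \<times> E))) \<and>
     (\<forall>t\<ge>0. \<forall>x\<in>E.
        u t x + (\<integral>\<omega>. (LINT s:{0..t}|lborel. \<psi> \<beta> \<alpha> (\<omega> s) (u (t - s) (\<omega> s))) \<partial>P x)
          = (\<integral>\<omega>. f (\<omega> t) + (LINT s:{0..t}|lborel. \<phi> (\<omega> s)) \<partial>P x))"

definition superprocess ::
    "'a::topological_space set \<Rightarrow> ('a \<Rightarrow> (real \<Rightarrow> 'a) measure) \<Rightarrow> ('a \<Rightarrow> real) \<Rightarrow> ('a \<Rightarrow> real) \<Rightarrow>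
     ('a measure \<Rightarrow> (real \<Rightarrow> 'a measure) measure) \<Rightarrow> bool" where
  "superprocess E P \<beta> \<alpha> \<P> \<longleftrightarrow>
     markov_family (finite_measure_algebra (borel_on E)) (continuous_measure_paths E) \<P> \<and>
     (\<forall>f\<in>bounded_nonneg_measurable E. \<forall>\<phi>\<in>bounded_nonneg_measurable E.
        \<exists>u. cumulant_solution E P \<beta> \<alpha> f \<phi> u \<and>
            (\<forall>v. cumulant_solution E P \<beta> \<alpha> f \<phi> v \<longrightarrow> (\<forall>t\<ge>0. \<forall>x\<in>E. v t x = u t x)) \<and>
            (\<forall>\<nu>\<in>finite_measures E. \<forall>t\<ge>0.
               (\<integral>X. exp (- (\<integral>x. f x \<partial>X t) - (LINT s:{0..t}|lborel. (\<integral>x. \<phi> x \<partial>X s))) \<partial>\<P> \<nu>)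
                 = exp (- (\<integral>x. u t x \<partial>\<nu>))))"

definition H_max :: "'a::topological_space set \<Rightarrow> (real \<Rightarrow> 'a measure) \<Rightarrow> ereal" where
  "H_max E X = Inf {ereal t | t. t > 0 \<and> X t = null_measure (borel_on E)}"

definition global_extinction ::
    "'a::topological_space set \<Rightarrow> ('a measure \<Rightarrow> (real \<Rightarrow> 'a measure) measure) \<Rightarrow> bool" where
  "global_extinction E \<P> \<longleftrightarrow>
     (\<forall>\<nu>\<in>finite_measures E. measure (\<P> \<nu>) {X \<in> space (\<P> \<nu>). H_max E X < \<infinity>} = 1)"


section \<open>The generalized eigenvalue\<close>

definition positive_harmonic ::
    "'a::topological_space set \<Rightarrow> ('a \<Rightarrow> (real \<Rightarrow> 'a) measure) \<Rightarrow> ('a \<Rightarrow> real) \<Rightarrow> real \<Rightarrow> ('a \<Rightarrow> real) set" where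
  "positive_harmonic E P \<beta> l =
     {u \<in> Dom E P. \<forall>x\<in>E. u x > 0 \<and> \<beta> x * u x - generator E P u x = l * u x}"

text \<open>The supremum is taken in the extended reals, where it always exists.\<close>

definition generalized_eigenvalue ::
    "'a::topological_space set \<Rightarrow> ('a \<Rightarrow> (real \<Rightarrow> 'a) measure) \<Rightarrow> ('a \<Rightarrow> real) \<Rightarrow> ereal" where
  "generalized_eigenvalue E P \<beta> = Sup {ereal l | l. positive_harmonic E P \<beta> l \<noteq> {}}"

end

theory Submission
  imports Defs
begin

text \<open>Let \<open>u\<close> solve the cumulant equation with constant initial value \<open>\<theta>\<close>. With
  \<open>c = C\<^sub>1 inf \<alpha>\<close>, the function \<open>\<phi>\<^sub>0(x) / (c t + C\<^sub>1/\<theta>)\<close> is a supersolution of the same equation,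
  because \<open>\<L> \<phi>\<^sub>0 = (\<beta> - \<lambda>\<^sub>0) \<phi>\<^sub>0\<close>, \<open>\<lambda>\<^sub>0 \<ge> 0\<close> and \<open>g = 1/(c t + d)\<close> solves \<open>g' = - c g\<^sup>2\<close>. Comparison in the
  mild form of the equation gives \<open>u\<^sub>t \<le> C\<^sub>2/(c t)\<close> uniformly in \<open>\<theta>\<close>. Letting \<open>\<theta> \<rightarrow> \<infinity>\<close> in the Laplace
  transform of the total mass yields \<open>\<P>\<^sub>\<nu>(X\<^sub>t = 0) \<ge> exp (- C\<^sub>2 \<nu>(E)/(c t))\<close>, which tends to \<open>1\<close>
  as \<open>t \<rightarrow> \<infinity>\<close>.\<close>

text \<open>The cumulant solution is only jointly measurable and known through its mild equation,
  and \<open>Dom\<close> is defined by a martingale problem, so a pointwise maximum principle is out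
  of reach. Instead the functions are read along the curve that applies the semigroup for time s to
  the slice at time t - s. By the semigroup property this curve is a constant minus a Lebesgue
  primitive, and it may be multiplied by a smooth weight. The weight 1/(c (t - s) + d) turns
  Dynkin's formula for \<open>\<phi>\<^sub>0\<close> into the mild equation of the supersolution;
  the weight exp(- K s) absorbs the zeroth-order term of the comparison, whose sign is not
  controlled. The value d = \<open>C\<^sub>1\<close> / \<open>\<theta>\<close> makes the
  supersolution start at or above \<open>\<theta>\<close>, and as d only enlarges the denominator,
  dropping it leaves a bound free of \<open>\<theta>\<close>. Finally,
  \<open>H_max E X < \<infinity>\<close> is an uncountable union over times, and
  \<open>measure\<close> is 0 on sets that are not events. Continuity of the total mass reduces this
  union to rational times.\<close>

section \<open>Integration by parts for primitives\<close>

lemma set_integrable_bounded_Icc: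
  fixes f :: "real \<Rightarrow> real"
  assumes "(\<lambda>s. indicator {a..b} s * f s) \<in> borel_measurable borel"
    and "\<And>s. s \<in> {a..b} \<Longrightarrow> \<bar>f s\<bar> \<le> M"
  shows "set_integrable lborel {a..b} f"
  unfolding set_integrable_def
  using assms by (intro integrableI_bounded_set[where A="{a..b}" and B=M])
    (auto simp: indicator_def emeasure_lborel_Icc_eq abs_le_iff)

lemma set_integral_FTC_Icc:
  fixes h h' :: "real \<Rightarrow> real"
  assumes "a \<le> b" "\<And>s. s \<in> {a..b} \<Longrightarrow> (h has_real_derivative h' s) (at s)" "continuous_on {a..b} h'"
  shows "(LINT s:{a..b}|lborel. h' s) = h b - h a"
proof -
  have "(\<integral>s. indicator {a..b} s *\<^sub>R h' s \<partial>lborel) = h b - h a"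
    using assms by (intro integral_FTC_Icc)
      (auto intro: has_vector_derivative_at_within simp: has_real_derivative_iff_has_vector_derivative)
  then show ?thesis by (simp add: set_lebesgue_integral_def)
qed

lemma set_integrable_continuous_Icc:
  fixes f :: "real \<Rightarrow> real"
  assumes "continuous_on {a..b} f"
  shows "set_integrable lborel {a..b} f"
  using borel_integrable_compact[of "{a..b}" f] assms
  by (simp add: set_integrable_def)

text \<open>A primitive of a merely measurable \<open>a\<close> need not be differentiable, so the
  product rule for \<open>h * B\<close>, where \<open>B\<close> has density \<open>a\<close> and
  ends at \<open>F\<close>, is replaced by Fubini on the triangle \<open>s \<le> q\<close>. It
  serves twice, for an exponential \<open>h\<close> and for the reciprocal of a linear
  function.\<close>

lemma integration_by_parts_primitive:
  fixes a h h' B :: "real \<Rightarrow> real"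
  assumes t: "0 \<le> t"
    and a[measurable]: "a \<in> borel_measurable borel" and a_bound: "\<And>s. \<bar>a s\<bar> \<le> M"
    and h: "\<And>s. s \<in> {0..t} \<Longrightarrow> (h has_real_derivative h' s) (at s)"
    and h': "continuous_on {0..t} h'"
    and B: "\<And>s. s \<in> {0..t} \<Longrightarrow> B s = F - (LINT q:{s..t}|lborel. a q)"
  shows "set_integrable lborel {0..t} (\<lambda>s. h s * a s + h' s * B s)" (is ?int)
    and "(LINT s:{0..t}|lborel. h s * a s + h' s * B s) = h t * F - h 0 * B 0" (is ?eq)
proof -
  \<comment> \<open>Integrating in \<open>q\<close> first gives \<open>h' s\<close> times the tail
    integral of \<open>a\<close>; integrating in \<open>s\<close> first gives
    \<open>(h q - h 0) * a q\<close>.\<close>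
  let ?f = "\<lambda>s q. indicator {0..t} s * h' s * (indicator {0..t} q * a q * (if s \<le> q then 1 else 0))"
  have h_cont: "continuous_on {0..t} h"
    using h by (meson DERIV_isCont continuous_at_imp_continuous_on)
  have h_meas[measurable]: "(\<lambda>s. indicator {0..t} s * h s) \<in> borel_measurable borel"
    and h'_meas[measurable]: "(\<lambda>s. indicator {0..t} s * h' s) \<in> borel_measurable borel"
    using borel_measurable_continuous_on_indicator[OF _ h_cont] borel_measurable_continuous_on_indicator[OF _ h']
    by simp_all
  obtain C where C: "\<And>s. s \<in> {0..t} \<Longrightarrow> \<bar>h' s\<bar> \<le> C"
    using compact_imp_bounded[OF compact_continuous_image[OF h' compact_Icc]]
    unfolding bounded_real by (metis imageI)
  obtain D where D: "\<And>s. s \<in> {0..t} \<Longrightarrow> \<bar>h s\<bar> \<le> D"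
    using compact_imp_bounded[OF compact_continuous_image[OF h_cont compact_Icc]]
    unfolding bounded_real by (metis imageI)
  have M: "0 \<le> M" using a_bound[of 0] by linarith
  have f: "integrable (lborel \<Otimes>\<^sub>M lborel) (\<lambda>(s, q). ?f s q)"
  proof (rule integrableI_bounded_set[where A="{0..t} \<times> {0..t}" and B="C * M"])
    show "(\<lambda>(s, q). ?f s q) \<in> borel_measurable (lborel \<Otimes>\<^sub>M lborel)" by measurable
    show "emeasure (lborel \<Otimes>\<^sub>M lborel) ({0..t} \<times> {0..t}) < \<infinity>"
      using t by (subst sigma_finite_measure.emeasure_pair_measure_Times)
        (auto simp: sigma_finite_lborel ennreal_mult[symmetric])
    have "\<bar>h' s * a q\<bar> \<le> C * M" if "s \<in> {0..t}" for s q
      using C[OF that] a_bound[of q] unfolding abs_mult by (intro mult_mono) auto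
    then show "AE x in lborel \<Otimes>\<^sub>M lborel. x \<in> {0..t} \<times> {0..t} \<longrightarrow> norm (case x of (s, q) \<Rightarrow> ?f s q) \<le> C * M"
      using M by (intro AE_I2) (force simp: indicator_def)
  qed (auto simp: indicator_def)
  have ha: "set_integrable lborel {0..t} (\<lambda>s. h s * a s)"
  proof (rule set_integrable_bounded_Icc[where M="D * M"])
    show "(\<lambda>s. indicator {0..t} s * (h s * a s)) \<in> borel_measurable borel"
      unfolding mult.assoc[symmetric] by measurable
    show "\<bar>h s * a s\<bar> \<le> D * M" if "s \<in> {0..t}" for s
      using D[OF that] a_bound[of s] unfolding abs_mult by (intro mult_mono) auto
  qed
  have a_int: "set_integrable lborel {0..t} a"
    by (rule set_integrable_bounded_Icc[where M=M]) (auto simp: a_bound)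
  have h'_int: "set_integrable lborel {0..t} h'"
    by (rule set_integrable_continuous_Icc[OF h'])
  have inner: "(\<integral>q. ?f s q \<partial>lborel) = indicator {0..t} s * (h' s * (LINT q:{s..t}|lborel. a q))" for s
    unfolding set_lebesgue_integral_def
    by (subst integral_mult_right_zero)
      (auto simp: indicator_def intro!: Bochner_Integration.integral_cong)
  have outer: "(\<integral>s. ?f s q \<partial>lborel) = indicator {0..t} q * ((h q - h 0) * a q)" for q
  proof (cases "q \<in> {0..t}")
    case True
    have "(\<integral>s. ?f s q \<partial>lborel) = (\<integral>s. (indicator {0..q} s *\<^sub>R h' s) * a q \<partial>lborel)"
      using True by (intro Bochner_Integration.integral_cong) (auto simp: indicator_def)
    also have "\<dots> = (LINT s:{0..q}|lborel. h' s) * a q"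
      by (simp add: set_lebesgue_integral_def)
    also have "(LINT s:{0..q}|lborel. h' s) = h q - h 0"
      using True h h' by (intro set_integral_FTC_Icc) (auto intro: continuous_on_subset)
    finally show ?thesis using True by simp
  qed simp
  have "integrable lborel (\<lambda>s. \<integral>q. ?f s q \<partial>lborel)"
    using lborel_pair.integrable_fst'[OF f] by (simp only: prod.case)
  then have prim: "set_integrable lborel {0..t} (\<lambda>s. h' s * (LINT q:{s..t}|lborel. a q))"
    unfolding inner set_integrable_def by simp
  have "(LINT s:{0..t}|lborel. h' s * (LINT q:{s..t}|lborel. a q)) = (\<integral>s. \<integral>q. ?f s q \<partial>lborel \<partial>lborel)"
    unfolding inner set_lebesgue_integral_def by simp
  also have "\<dots> = (\<integral>q. \<integral>s. ?f s q \<partial>lborel \<partial>lborel)"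
    by (rule lborel_pair.Fubini_integral[OF f, symmetric])
  also have "\<dots> = (LINT q:{0..t}|lborel. h q * a q - h 0 * a q)"
    unfolding outer set_lebesgue_integral_def by (simp add: algebra_simps)
  also have "\<dots> = (LINT q:{0..t}|lborel. h q * a q) - h 0 * (LINT q:{0..t}|lborel. a q)"
    using ha a_int by (subst set_integral_diff(2)) auto
  finally have fubini: "(LINT s:{0..t}|lborel. h' s * (LINT q:{s..t}|lborel. a q))
    = (LINT q:{0..t}|lborel. h q * a q) - h 0 * (LINT q:{0..t}|lborel. a q)" .
  have eq: "h s * a s + h' s * B s = h s * a s + (h' s * F - h' s * (LINT q:{s..t}|lborel. a q))"
    if "s \<in> {0..t}" for s
    by (simp add: B[OF that] algebra_simps)
  have int: "set_integrable lborel {0..t} (\<lambda>s. h s * a s + (h' s * F - h' s * (LINT q:{s..t}|lborel. a q)))"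
    using ha h'_int prim by (intro set_integral_add(1) set_integral_diff(1)) auto
  show ?int
    using int eq by (subst set_integrable_cong[OF refl refl eq]) auto
  have "(LINT s:{0..t}|lborel. h s * a s + h' s * B s)
     = (LINT s:{0..t}|lborel. h s * a s + (h' s * F - h' s * (LINT q:{s..t}|lborel. a q)))"
    using eq by (intro set_lebesgue_integral_cong) auto
  also have "\<dots> = (LINT s:{0..t}|lborel. h s * a s) + ((LINT s:{0..t}|lborel. h' s) * F
      - (LINT s:{0..t}|lborel. h' s * (LINT q:{s..t}|lborel. a q)))"
    using ha h'_int prim by (subst set_integral_add(2), simp, simp, subst set_integral_diff(2)) auto
  also have "(LINT s:{0..t}|lborel. h' s) = h t - h 0"
    using t h h' by (rule set_integral_FTC_Icc)
  finally have eq: "(LINT s:{0..t}|lborel. h s * a s + h' s * B s) = h t * F - h 0 * (F - (LINT q:{0..t}|lborel. a q))"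
    by (simp add: fubini algebra_simps)
  have B0: "B 0 = F - (LINT q:{0..t}|lborel. a q)" using B[of 0] t by simp
  show ?eq unfolding eq B0 ..
qed

section \<open>The semigroup of the spatial motion\<close>

lemma measurable_path_eval:
  assumes "0 \<le> s"
  shows "(\<lambda>\<omega>. \<omega> s) \<in> path_algebra S W \<rightarrow>\<^sub>M S"
  unfolding path_algebra_def using assms
  by (intro measurable_restrict_space1 measurable_component_singleton) auto

lemma space_path_algebra: "space (path_algebra S W) = W \<inter> ({0..} \<rightarrow>\<^sub>E space S)"
  by (auto simp: path_algebra_def space_restrict_space space_PiM)

lemma space_borel_on[simp]: "space (borel_on E) = E"
  by (simp add: space_restrict_space)

lemma space_cadlag_paths: "space (path_algebra (borel_on E) (cadlag_paths E)) = cadlag_paths E"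
  by (auto simp: space_path_algebra cadlag_paths_def)

lemma cadlag_paths_in: "\<omega> \<in> cadlag_paths E \<Longrightarrow> 0 \<le> s \<Longrightarrow> \<omega> s \<in> E"
  by (auto simp: cadlag_paths_def)

lemma shift_apply: "0 \<le> t \<Longrightarrow> shift s \<omega> t = \<omega> (s + t)"
  by (simp add: shift_def)

text \<open>Events of the path algebra contain only cadlag paths. Hence, for \<open>A\<close> a
  preimage under an evaluation, \<open>shift s \<omega> \<in> A\<close> reduces to a condition on
  one value of the path only once the shifted path is known to be cadlag.\<close>

lemma shift_cadlag_paths:
  assumes \<omega>: "\<omega> \<in> cadlag_paths E" and s: "0 \<le> s"
  shows "shift s \<omega> \<in> cadlag_paths E"
proof -
  have "shift s \<omega> \<in> {0..} \<rightarrow>\<^sub>E E"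
    using \<omega> s by (auto simp: cadlag_paths_def shift_def PiE_iff)
  moreover have "(shift s \<omega> \<longlongrightarrow> shift s \<omega> t) (at_right t)" if t: "0 \<le> t" for t
  proof -
    have "(\<omega> \<longlongrightarrow> \<omega> (s + t)) (at_right (s + t))"
      using \<omega> s t by (auto simp: cadlag_paths_def)
    then have "((\<lambda>r. \<omega> (s + r)) \<longlongrightarrow> \<omega> (s + t)) (at_right t)"
      by (rule filterlim_compose) (auto simp: filterlim_at eventually_at_filter intro!: tendsto_eq_intros)
    moreover have "eventually (\<lambda>r. \<omega> (s + r) = shift s \<omega> r) (at_right t)"
      using t by (auto simp: eventually_at_filter shift_apply intro!: always_eventually)
    ultimately show ?thesis
      using t by (auto simp: shift_apply intro: Lim_transform_eventually)
  qed
  moreover have "\<exists>l\<in>E. (shift s \<omega> \<longlongrightarrow> l) (at_left t)" if t: "0 < t" for t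
  proof -
    obtain l where l: "l \<in> E" "(\<omega> \<longlongrightarrow> l) (at_left (s + t))"
      using \<omega> s t by (auto simp: cadlag_paths_def dest!: spec[of _ "s + t"])
    have "((\<lambda>r. \<omega> (s + r)) \<longlongrightarrow> l) (at_left t)"
      using l(2)
      by (rule filterlim_compose) (auto simp: filterlim_at eventually_at_filter intro!: tendsto_eq_intros)
    moreover have "eventually (\<lambda>r. \<omega> (s + r) = shift s \<omega> r) (at_left t)"
      using eventually_at_left_real[OF t] by eventually_elim (simp add: shift_apply)
    ultimately show ?thesis
      using l(1) by (auto intro: Lim_transform_eventually)
  qed
  ultimately show ?thesis by (auto simp: cadlag_paths_def)
qed

text \<open>By right-continuity the value of a path is the limit of its values at grid points
  approaching from the right. For a fixed mesh the grid point takes countably many values, so each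
  approximant is measurable.\<close>

lemma measurable_cadlag_eval_joint:
  fixes E :: "'a::metric_space set"
  shows "(\<lambda>(s, \<omega>). \<omega> (max 0 s)) \<in> borel \<Otimes>\<^sub>M path_algebra (borel_on E) (cadlag_paths E) \<rightarrow>\<^sub>M borel_on E"
    (is "_ \<in> ?M \<rightarrow>\<^sub>M _")
proof (rule measurable_restrict_space2)
  show "(\<lambda>(s, \<omega>). \<omega> (max 0 s)) \<in> space ?M \<rightarrow> E"
    by (auto simp: space_pair_measure space_cadlag_paths cadlag_paths_in)
  \<comment> \<open>The next point strictly after \<open>s\<close> on the grid of mesh
    \<open>1 / Suc n\<close>. The \<open>+ 1\<close> matters: the limit from the right is taken
    along times greater than \<open>s\<close>.\<close>
  define d :: "nat \<Rightarrow> real \<Rightarrow> real" where "d n s = (real (nat \<lfloor>real (Suc n) * s\<rfloor>) + 1) / real (Suc n)" for n s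
  have d: "s < d n s" "d n s \<le> s + inverse (real (Suc n))" if "0 \<le> s" for n s
  proof -
    define N where "N = real (Suc n)"
    have N: "0 < N" by (simp add: N_def)
    have "real (nat \<lfloor>N * s\<rfloor>) \<le> N * s" "N * s < real (nat \<lfloor>N * s\<rfloor>) + 1"
      using that N by (simp_all add: of_nat_nat)
    then have "s < (real (nat \<lfloor>N * s\<rfloor>) + 1) / N" "(real (nat \<lfloor>N * s\<rfloor>) + 1) / N \<le> s + inverse N"
      using N by (simp_all add: field_simps)
    then show "s < d n s" "d n s \<le> s + inverse (real (Suc n))"
      by (simp_all only: d_def N_def)
  qed
  show "(\<lambda>(s, \<omega>). \<omega> (max 0 s)) \<in> borel_measurable ?M"
  proof (rule borel_measurable_LIMSEQ_metric)
    fix n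
    have "(\<lambda>x. snd x ((real k + 1) / real (Suc n))) \<in> borel_measurable ?M" for k
      using measurable_path_eval[of "(real k + 1) / real (Suc n)" "borel_on E" "cadlag_paths E"]
      by (intro measurable_compose[OF measurable_snd]) (auto simp: measurable_restrict_space2_iff)
    then show "(\<lambda>x. snd x (d n (max 0 (fst x)))) \<in> borel_measurable ?M"
      unfolding d_def
      by (rule measurable_compose_countable[where g="\<lambda>x. nat \<lfloor>real (Suc n) * max 0 (fst x)\<rfloor>"]) measurable
  next
    fix x assume "x \<in> space ?M"
    then obtain s \<omega> where x: "x = (s, \<omega>)" and \<omega>: "\<omega> \<in> cadlag_paths E"
      by (auto simp: space_pair_measure space_cadlag_paths)
    have lim: "(\<lambda>n. max 0 s + inverse (real (Suc n))) \<longlonglongrightarrow> max 0 s"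
      using tendsto_add[OF tendsto_const LIMSEQ_inverse_real_of_nat, of "max 0 s"] by simp
    have "(\<lambda>n. d n (max 0 s)) \<longlonglongrightarrow> max 0 s"
      by (rule tendsto_sandwich[OF _ _ tendsto_const lim]) (intro always_eventually allI d(2) less_imp_le[OF d(1)] max.cobounded1)+
    then have "filterlim (\<lambda>n. d n (max 0 s)) (at_right (max 0 s)) sequentially"
      using d(1)[OF max.cobounded1] unfolding filterlim_at by (simp add: order_less_imp_le less_imp_neq[symmetric] del: max_less_iff_conj)
    moreover have "(\<omega> \<longlongrightarrow> \<omega> (max 0 s)) (at_right (max 0 s))"
      using \<omega> by (auto simp: cadlag_paths_def)
    ultimately show "(\<lambda>n. snd x (d n (max 0 (fst x)))) \<longlonglongrightarrow> (case x of (s, \<omega>) \<Rightarrow> \<omega> (max 0 s))"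
      unfolding x by (auto intro: filterlim_compose)
  qed
qed

section \<open>Bounded space-time functions and integrals against kernels\<close>

text \<open>Times are truncated at \<open>0\<close> so that space-time functions may live on all of \<open>\<real>\<close>.\<close>

definition evolve :: "('a \<Rightarrow> (real \<Rightarrow> 'a) measure) \<Rightarrow> real \<Rightarrow> ('a \<Rightarrow> real) \<Rightarrow> 'a \<Rightarrow> real" where
  "evolve P s h x = (\<integral>\<omega>. h (\<omega> (max 0 s)) \<partial>P x)"

text \<open>Requiring the bound on the whole time line, not only on compact time sets, makes the
  class stable under time changes such as \<open>s \<mapsto> t - s\<close>, and integrable over path
  space times a bounded interval.\<close>

definition bounded_field :: "'a measure \<Rightarrow> (real \<Rightarrow> 'a \<Rightarrow> real) \<Rightarrow> bool" where
  "bounded_field S H \<longleftrightarrow> case_prod H \<in> borel_measurable (borel \<Otimes>\<^sub>M S) \<and>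
     (\<exists>M. \<forall>s. \<forall>x\<in>space S. \<bar>H s x\<bar> \<le> M)"

lemma bounded_field_measurable:
  "bounded_field S H \<Longrightarrow> case_prod H \<in> borel_measurable (borel \<Otimes>\<^sub>M S)"
  by (simp add: bounded_field_def)

lemma bounded_field_bound:
  assumes "bounded_field S H"
  obtains M where "0 \<le> M" "\<And>s x. x \<in> space S \<Longrightarrow> \<bar>H s x\<bar> \<le> M"
proof -
  from assms obtain M where "\<forall>s. \<forall>x\<in>space S. \<bar>H s x\<bar> \<le> M" by (auto simp: bounded_field_def)
  then show thesis by (intro that[of "max 0 M"]) (auto simp: le_max_iff_disj)
qed

lemma bounded_field_comp:
  assumes H: "bounded_field S H" and g[measurable]: "g \<in> borel_measurable borel"
  shows "bounded_field S (\<lambda>s. H (g s))"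
proof -
  note [measurable] = bounded_field_measurable[OF H]
  obtain M where "\<And>s x. x \<in> space S \<Longrightarrow> \<bar>H s x\<bar> \<le> M"
    by (rule bounded_field_bound[OF H]) blast
  moreover have "(\<lambda>(s, x). H (g s) x) \<in> borel_measurable (borel \<Otimes>\<^sub>M S)"
    by measurable
  ultimately show ?thesis
    unfolding bounded_field_def by auto
qed

lemma bounded_field_section:
  assumes H: "bounded_field S H"
  shows "H s \<in> borel_measurable S"
  using measurable_Pair2[OF bounded_field_measurable[OF H], of s] by simp

lemma bounded_field_space:
  assumes "f \<in> borel_measurable S" "\<And>x. x \<in> space S \<Longrightarrow> \<bar>f x\<bar> \<le> M"
  shows "bounded_field S (\<lambda>_. f)"
  unfolding bounded_field_def using assms by auto

text \<open>Integrand and measure both depend on \<open>x\<close>. Pushing \<open>L x\<close>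
  forward by \<open>y \<mapsto> (x, y)\<close> gives a kernel into the product space, where the
  integrand no longer varies with \<open>x\<close>.\<close>

lemma integral_measurable_kernel:
  fixes f :: "'a \<Rightarrow> 'b \<Rightarrow> real"
  assumes f[measurable]: "case_prod f \<in> borel_measurable (M \<Otimes>\<^sub>M N)"
    and L[measurable]: "L \<in> M \<rightarrow>\<^sub>M subprob_algebra N"
  shows "(\<lambda>x. \<integral>y. f x y \<partial>L x) \<in> borel_measurable M"
proof -
  have "(\<lambda>x. distr (L x) (M \<Otimes>\<^sub>M N) (\<lambda>y. (x, y))) \<in> M \<rightarrow>\<^sub>M subprob_algebra (M \<Otimes>\<^sub>M N)"
    by (rule measurable_distr2[OF _ L]) simp
  then have "(\<lambda>x. integral\<^sup>L (distr (L x) (M \<Otimes>\<^sub>M N) (\<lambda>y. (x, y))) (case_prod f)) \<in> borel_measurable M"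
    by (rule measurable_compose[OF _ integral_measurable_subprob_algebra[OF f]])
  then show ?thesis
  proof (rule measurable_cong[THEN iffD1, rotated])
    fix x assume x: "x \<in> space M"
    have "(\<lambda>y. (x, y)) \<in> L x \<rightarrow>\<^sub>M M \<Otimes>\<^sub>M N"
      using subprob_measurableD(3)[OF L x] x by simp
    from integral_distr[OF this f]
    show "integral\<^sup>L (distr (L x) (M \<Otimes>\<^sub>M N) (\<lambda>y. (x, y))) (case_prod f) = (\<integral>y. f x y \<partial>L x)"
      by simp
  qed
qed

section \<open>The transition semigroup of a cadlag Markov motion\<close>

locale cadlag_markov =
  fixes E :: "'a::metric_space set" and P :: "'a \<Rightarrow> (real \<Rightarrow> 'a) measure"
  assumes markov: "markov_family (borel_on E) (cadlag_paths E) P"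
begin

abbreviation "W \<equiv> path_algebra (borel_on E) (cadlag_paths E)"

lemma markov_property:
  assumes "x \<in> E" "0 \<le> s" "B \<in> sets (natural_filtration (borel_on E) (cadlag_paths E) s)" "A \<in> sets W"
  shows "emeasure (P x) {\<omega> \<in> B. shift s \<omega> \<in> A} = (\<integral>\<^sup>+\<omega>. emeasure (P (\<omega> s)) A * indicator B \<omega> \<partial>P x)"
  by (rule markov[unfolded markov_family_def space_borel_on, THEN conjunct2, THEN conjunct2, rule_format, OF assms])

lemma kernel: "P \<in> borel_on E \<rightarrow>\<^sub>M prob_algebra W"
  using markov unfolding markov_family_def by (rule conjunct1)

lemma kernel_subprob[measurable]: "P \<in> borel_on E \<rightarrow>\<^sub>M subprob_algebra W"
  using kernel by (rule measurable_prob_algebraD)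

lemma prob_space_P: "x \<in> E \<Longrightarrow> prob_space (P x)"
  and sets_P: "x \<in> E \<Longrightarrow> sets (P x) = sets W"
  using measurable_space[OF kernel, of x] by (auto simp: space_prob_algebra)

lemma space_P: "x \<in> E \<Longrightarrow> space (P x) = cadlag_paths E"
  using sets_eq_imp_space_eq[OF sets_P] by (simp add: space_cadlag_paths)

lemma path_in: "x \<in> E \<Longrightarrow> \<omega> \<in> space (P x) \<Longrightarrow> 0 \<le> s \<Longrightarrow> \<omega> s \<in> E"
  by (auto simp: space_P cadlag_paths_def)

lemma eval_joint[measurable]: "(\<lambda>(s, \<omega>). \<omega> (max 0 s)) \<in> borel \<Otimes>\<^sub>M W \<rightarrow>\<^sub>M borel_on E"
  by (rule measurable_cadlag_eval_joint)

lemma eval_P: "x \<in> E \<Longrightarrow> 0 \<le> s \<Longrightarrow> (\<lambda>\<omega>. \<omega> s) \<in> P x \<rightarrow>\<^sub>M borel_on E"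
  using measurable_path_eval by (subst measurable_cong_sets[OF sets_P refl])

lemma integrable_P:
  assumes x: "x \<in> E" and f: "f \<in> borel_measurable W"
    and bound: "\<And>\<omega>. \<omega> \<in> cadlag_paths E \<Longrightarrow> \<bar>f \<omega>\<bar> \<le> (M::real)"
  shows "integrable (P x) f"
proof -
  interpret prob_space "P x" by (rule prob_space_P[OF x])
  show ?thesis
    using f bound x
    by (intro integrable_const_bound[where B=M]) (auto simp: space_P measurable_cong_sets[OF sets_P[OF x]])
qed

text \<open>The integral of a non-integrable function is \<open>0\<close> by convention, which the
  bound covers because \<open>0 \<le> M\<close>: a probability space contains at least one
  path.\<close>

lemma integral_P_abs_le:
  assumes x: "x \<in> E" and bound: "\<And>\<omega>. \<omega> \<in> cadlag_paths E \<Longrightarrow> \<bar>f \<omega>\<bar> \<le> (M::real)"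
  shows "\<bar>\<integral>\<omega>. f \<omega> \<partial>P x\<bar> \<le> M"
proof -
  interpret prob_space "P x" by (rule prob_space_P[OF x])
  obtain \<omega> where "\<omega> \<in> cadlag_paths E" using not_empty space_P[OF x] by auto
  then have M: "0 \<le> M" using bound[of \<omega>] by linarith
  have "norm (\<integral>\<omega>. f \<omega> \<partial>P x) \<le> (\<integral>\<omega>. M \<partial>P x)" if "integrable (P x) f"
  proof -
    have "norm (\<integral>\<omega>. f \<omega> \<partial>P x) \<le> (\<integral>\<omega>. norm (f \<omega>) \<partial>P x)" by (rule integral_norm_bound)
    also have "\<dots> \<le> (\<integral>\<omega>. M \<partial>P x)"
      using that bound by (intro integral_mono) (auto simp: space_P[OF x])
    finally show ?thesis .
  qed
  then show ?thesis
    using M by (cases "integrable (P x) f") (auto simp: prob_space not_integrable_integral_eq)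
qed

text \<open>The observation time of the motion and the time argument of \<open>H\<close> vary
  together, so measurability comes from the joint evaluation map and not from evaluation at fixed
  times.\<close>

lemma bounded_field_evolve:
  assumes H: "bounded_field (borel_on E) H"
  shows "bounded_field (borel_on E) (\<lambda>s. evolve P s (H s))"
proof -
  note [measurable] = bounded_field_measurable[OF H]
  obtain M where "0 \<le> M" and M: "\<And>s x. x \<in> E \<Longrightarrow> \<bar>H s x\<bar> \<le> M"
    by (rule bounded_field_bound[OF H, unfolded space_borel_on]) blast
  have "(\<lambda>z. (fst (fst z), snd z (max 0 (fst (fst z))))) \<in> (borel \<Otimes>\<^sub>M borel_on E) \<Otimes>\<^sub>M W \<rightarrow>\<^sub>M borel \<Otimes>\<^sub>M borel_on E"
    using measurable_compose[OF _ eval_joint, of "\<lambda>z. (fst (fst z), snd z)" "(borel \<Otimes>\<^sub>M borel_on E) \<Otimes>\<^sub>M W"]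
    by simp
  from measurable_compose[OF this bounded_field_measurable[OF H]]
  have "(\<lambda>z. \<integral>\<omega>. H (fst z) (\<omega> (max 0 (fst z))) \<partial>P (snd z)) \<in> borel_measurable (borel \<Otimes>\<^sub>M borel_on E)"
    by (intro integral_measurable_kernel[where N=W]) (simp_all add: split_beta' measurable_compose[OF measurable_snd kernel_subprob])
  moreover have "\<bar>evolve P s (H s) x\<bar> \<le> M" if "x \<in> E" for s x
    unfolding evolve_def using that
    by (intro integral_P_abs_le M) (auto simp: cadlag_paths_in)
  ultimately show ?thesis
    by (auto simp: bounded_field_def evolve_def split_beta')
qed

text \<open>Common source of two exchanges: expectation with a time integral along the path, and
  expectation with a time integral evaluated at one fixed position of the path.\<close>

lemma integral_P_Fubini:
  fixes K :: "real \<Rightarrow> (real \<Rightarrow> 'a) \<Rightarrow> real"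
  assumes x: "x \<in> E" and K: "case_prod K \<in> borel_measurable (borel \<Otimes>\<^sub>M W)"
    and M: "\<And>s \<omega>. s \<in> {a..b} \<Longrightarrow> \<omega> \<in> cadlag_paths E \<Longrightarrow> \<bar>K s \<omega>\<bar> \<le> M"
  shows "(\<integral>\<omega>. (LINT s:{a..b}|lborel. K s \<omega>) \<partial>P x) = (LINT s:{a..b}|lborel. \<integral>\<omega>. K s \<omega> \<partial>P x)"
proof -
  interpret prob_space "P x" by (rule prob_space_P[OF x])
  interpret L: pair_sigma_finite lborel "P x" by standard
  have "integrable (lborel \<Otimes>\<^sub>M P x) (\<lambda>(s, \<omega>). indicator {a..b} s * K s \<omega>)"
  proof (rule integrableI_bounded_set[where A="{a..b} \<times> space (P x)" and B=M])
    show "(\<lambda>(s, \<omega>). indicator {a..b} s * K s \<omega>) \<in> borel_measurable (lborel \<Otimes>\<^sub>M P x)"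
    proof (subst measurable_cong_sets[OF sets_pair_measure_cong[OF sets_lborel sets_P[OF x]] refl])
      have "(\<lambda>z. indicator {a..b} (fst z) * case_prod K z) \<in> borel_measurable (borel \<Otimes>\<^sub>M W)"
        by (intro borel_measurable_times K measurable_compose[OF measurable_fst]) simp
      then show "(\<lambda>(s, \<omega>). indicator {a..b} s * K s \<omega>) \<in> borel_measurable (borel \<Otimes>\<^sub>M W)"
        by (simp add: split_beta')
    qed
    show "emeasure (lborel \<Otimes>\<^sub>M P x) ({a..b} \<times> space (P x)) < \<infinity>"
      by (subst emeasure_pair_measure_Times) (auto simp: emeasure_space_1 emeasure_lborel_Icc_eq)
    show "{a..b} \<times> space (P x) \<in> sets (lborel \<Otimes>\<^sub>M P x)"
      by (intro pair_measureI) auto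
  qed (auto simp: indicator_def space_pair_measure space_P[OF x] M)
  from L.Fubini_integral[OF this] show ?thesis
    by (simp add: set_lebesgue_integral_def)
qed

lemma integral_path_Fubini:
  assumes x: "x \<in> E" and H: "bounded_field (borel_on E) H" and a: "0 \<le> a"
  shows "(\<integral>\<omega>. (LINT s:{a..b}|lborel. H s (\<omega> s)) \<partial>P x) = (LINT s:{a..b}|lborel. evolve P s (H s) x)"
proof -
  note [measurable] = bounded_field_measurable[OF H]
  obtain M where "0 \<le> M" and M: "\<And>s x. x \<in> E \<Longrightarrow> \<bar>H s x\<bar> \<le> M"
    by (rule bounded_field_bound[OF H, unfolded space_borel_on]) blast
  have "(\<integral>\<omega>. (LINT s:{a..b}|lborel. H s (\<omega> s)) \<partial>P x)
      = (\<integral>\<omega>. (LINT s:{a..b}|lborel. H s (\<omega> (max 0 s))) \<partial>P x)"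
    using a by (intro Bochner_Integration.integral_cong set_lebesgue_integral_cong) (auto simp: max_def)
  also have "\<dots> = (LINT s:{a..b}|lborel. \<integral>\<omega>. H s (\<omega> (max 0 s)) \<partial>P x)"
  proof (rule integral_P_Fubini[OF x])
    have "(\<lambda>(s, \<omega>). H s (case_prod (\<lambda>s \<omega>. \<omega> (max 0 s)) (s, \<omega>))) \<in> borel_measurable (borel \<Otimes>\<^sub>M W)"
      by measurable
    then show "(\<lambda>(s, \<omega>). H s (\<omega> (max 0 s))) \<in> borel_measurable (borel \<Otimes>\<^sub>M W)" by simp
  qed (rule M, simp add: cadlag_paths_in)
  finally show ?thesis by (simp add: evolve_def)
qed

lemma evolve_integral:
  assumes x: "x \<in> E" and H: "bounded_field (borel_on E) H"
  shows "evolve P r (\<lambda>y. LINT s:{a..b}|lborel. H s y) x = (LINT s:{a..b}|lborel. evolve P r (H s) x)"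
proof -
  note [measurable] = bounded_field_measurable[OF H]
  obtain M where "0 \<le> M" and M: "\<And>s x. x \<in> E \<Longrightarrow> \<bar>H s x\<bar> \<le> M"
    by (rule bounded_field_bound[OF H, unfolded space_borel_on]) blast
  show ?thesis
    unfolding evolve_def
  proof (rule integral_P_Fubini[OF x])
    have [measurable]: "(\<lambda>\<omega>. \<omega> (max 0 r)) \<in> W \<rightarrow>\<^sub>M borel_on E" by (rule measurable_path_eval) simp
    show "(\<lambda>(s, \<omega>). H s (\<omega> (max 0 r))) \<in> borel_measurable (borel \<Otimes>\<^sub>M W)" by measurable
  qed (rule M, simp add: cadlag_paths_in)
qed

lemma evolve_diff:
  assumes x: "x \<in> E" and "bounded_field (borel_on E) (\<lambda>_. f)" "bounded_field (borel_on E) (\<lambda>_. g)"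
  shows "evolve P r (\<lambda>y. f y - g y) x = evolve P r f x - evolve P r g x"
proof -
  have "integrable (P x) (\<lambda>\<omega>. h (\<omega> (max 0 r)))" if h: "bounded_field (borel_on E) (\<lambda>_. h)" for h
  proof -
    obtain M where "0 \<le> M" and M: "\<And>y. y \<in> E \<Longrightarrow> \<bar>h y\<bar> \<le> M"
    by (rule bounded_field_bound[OF h, unfolded space_borel_on]) blast
    show ?thesis
      using measurable_compose[OF measurable_path_eval bounded_field_section[OF h]]
      by (intro integrable_P[OF x, where M=M] M) (auto simp: cadlag_paths_in)
  qed
  then show ?thesis
    unfolding evolve_def using assms by (intro Bochner_Integration.integral_diff) auto
qed

lemma evolve_cmult: "evolve P r (\<lambda>y. c * f y) x = c * evolve P r f x"
  by (simp add: evolve_def)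

lemma evolve_ge:
  assumes x: "x \<in> E" and f: "bounded_field (borel_on E) (\<lambda>_. f)" and le: "\<And>y. y \<in> E \<Longrightarrow> c \<le> f y"
  shows "c \<le> evolve P r f x"
proof -
  interpret prob_space "P x" by (rule prob_space_P[OF x])
  obtain M where "0 \<le> M" and M: "\<And>y. y \<in> E \<Longrightarrow> \<bar>f y\<bar> \<le> M"
    by (rule bounded_field_bound[OF f, unfolded space_borel_on]) blast
  have "integrable (P x) (\<lambda>\<omega>. f (\<omega> (max 0 r)))"
    using measurable_compose[OF measurable_path_eval bounded_field_section[OF f]]
    by (intro integrable_P[OF x, where M=M] M) (auto simp: cadlag_paths_in)
  then have "(\<integral>\<omega>. c \<partial>P x) \<le> evolve P r f x"
    unfolding evolve_def using x by (intro integral_mono le path_in) auto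
  then show ?thesis by (simp add: prob_space)
qed

text \<open>Chapman-Kolmogorov. The Markov property at the fixed time \<open>s\<close>, with the
  whole path space as past event, says that the law of the position at \<open>s + r\<close> is the
  law at \<open>s\<close> composed with the transition kernel over time \<open>r\<close>.\<close>

lemma evolve_evolve:
  assumes x: "x \<in> E" and s: "0 \<le> s" and r: "0 \<le> r" and h: "bounded_field (borel_on E) (\<lambda>_. h)"
  shows "evolve P s (evolve P r h) x = evolve P (s + r) h x"
proof -
  interpret prob_space "P x" by (rule prob_space_P[OF x])
  have h_meas: "h \<in> borel_measurable (borel_on E)" by (rule bounded_field_section[OF h])
  obtain M where "0 \<le> M" and M: "\<And>y. y \<in> E \<Longrightarrow> \<bar>h y\<bar> \<le> M"
    by (rule bounded_field_bound[OF h, unfolded space_borel_on]) blast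
  let ?N = "\<lambda>\<omega>. distr (P (\<omega> s)) (borel_on E) (\<lambda>\<omega>. \<omega> r)"
  have eval_s[measurable]: "(\<lambda>\<omega>. \<omega> s) \<in> P x \<rightarrow>\<^sub>M borel_on E" by (rule eval_P[OF x s])
  have N0: "(\<lambda>y. distr (P y) (borel_on E) (\<lambda>\<omega>. \<omega> r)) \<in> borel_on E \<rightarrow>\<^sub>M subprob_algebra (borel_on E)"
    by (rule measurable_compose[OF kernel_subprob measurable_distr[OF measurable_path_eval[OF r]]])
  have N: "?N \<in> P x \<rightarrow>\<^sub>M subprob_algebra (borel_on E)"
    by (rule measurable_compose[OF eval_s N0])
  have eq: "distr (P x) (borel_on E) (\<lambda>\<omega>. \<omega> (s + r)) = P x \<bind> ?N"
  proof (rule measure_eqI)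
    show "sets (distr (P x) (borel_on E) (\<lambda>\<omega>. \<omega> (s + r))) = sets (P x \<bind> ?N)"
      using sets_bind[OF _ not_empty, of ?N "borel_on E"] by auto
    fix A assume "A \<in> sets (distr (P x) (borel_on E) (\<lambda>\<omega>. \<omega> (s + r)))"
    then have A: "A \<in> sets (borel_on E)" by simp
    \<comment> \<open>This future event depends on the shifted path only through its value at
      \<open>r\<close>, that is, on the original path at \<open>s + r\<close>.\<close>
    let ?A = "(\<lambda>\<omega>. \<omega> r) -` A \<inter> space W"
    have A': "?A \<in> sets W" by (rule measurable_sets[OF measurable_path_eval[OF r] A])
    have "cadlag_paths E = space (natural_filtration (borel_on E) (cadlag_paths E) s)"
      by (simp add: natural_filtration_def)
    then have B: "cadlag_paths E \<in> sets (natural_filtration (borel_on E) (cadlag_paths E) s)"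
      by (metis sets.top)
    have "emeasure (distr (P x) (borel_on E) (\<lambda>\<omega>. \<omega> (s + r))) A
        = emeasure (P x) {\<omega> \<in> cadlag_paths E. shift s \<omega> \<in> ?A}"
      using s r by (subst emeasure_distr[OF eval_P[OF x] A])
        (auto intro!: arg_cong[where f="emeasure (P x)"] simp: space_cadlag_paths shift_cadlag_paths shift_apply space_P[OF x])
    also have "\<dots> = (\<integral>\<^sup>+\<omega>. emeasure (P (\<omega> s)) ?A * indicator (cadlag_paths E) \<omega> \<partial>P x)"
      by (rule markov_property[OF x s B A'])
    also have "\<dots> = (\<integral>\<^sup>+\<omega>. emeasure (?N \<omega>) A \<partial>P x)"
    proof (rule nn_integral_cong)
      fix \<omega> assume \<omega>: "\<omega> \<in> space (P x)"
      then have y: "\<omega> s \<in> E" using path_in[OF x] s by auto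
      show "emeasure (P (\<omega> s)) ?A * indicator (cadlag_paths E) \<omega> = emeasure (?N \<omega>) A"
        using \<omega> by (subst emeasure_distr[OF eval_P[OF y r] A])
          (simp add: space_P[OF x] space_P[OF y] space_cadlag_paths)
    qed
    also have "\<dots> = emeasure (P x \<bind> ?N) A"
      by (rule emeasure_bind[OF not_empty N A, symmetric])
    finally show "emeasure (distr (P x) (borel_on E) (\<lambda>\<omega>. \<omega> (s + r))) A = emeasure (P x \<bind> ?N) A" .
  qed
  have "evolve P (s + r) h x = integral\<^sup>L (distr (P x) (borel_on E) (\<lambda>\<omega>. \<omega> (s + r))) h"
    unfolding evolve_def using s r by (subst integral_distr[OF eval_P[OF x] h_meas]) auto
  also have "\<dots> = (\<integral>\<omega>. integral\<^sup>L (?N \<omega>) h \<partial>P x)"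
    unfolding eq
  proof (rule integral_bind[OF h_meas _ N, where B=M and B'=1])
    show "AE \<omega> in P x. emeasure (?N \<omega>) (space (?N \<omega>)) \<le> ennreal 1"
    proof (rule AE_I2)
      fix \<omega> assume "\<omega> \<in> space (P x)"
      then have "subprob_space (?N \<omega>)"
        using measurable_space[OF N] by (simp add: space_subprob_algebra)
      then show "emeasure (?N \<omega>) (space (?N \<omega>)) \<le> ennreal 1"
        by (simp only: ennreal_1 subprob_space.emeasure_space_le_1)
    qed
  qed (auto simp: M intro: finite_measure_axioms)
  also have "\<dots> = (\<integral>\<omega>. (\<integral>\<omega>'. h (\<omega>' r) \<partial>P (\<omega> s)) \<partial>P x)"
    using path_in[OF x _ s]
    by (intro Bochner_Integration.integral_cong[OF refl] integral_distr[OF eval_P[OF _ r] h_meas]) auto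
  finally show ?thesis
    using s r by (simp add: evolve_def)
qed

end

section \<open>Comparison for mild solutions\<close>

lemma bounded_field_add:
  assumes "bounded_field S G" "bounded_field S H"
  shows "bounded_field S (\<lambda>s x. G s x + H s x)"
proof -
  note [measurable] = bounded_field_measurable[OF assms(1)] bounded_field_measurable[OF assms(2)]
  obtain M where M: "0 \<le> M" "\<And>s x. x \<in> space S \<Longrightarrow> \<bar>G s x\<bar> \<le> M" by (rule bounded_field_bound[OF assms(1)]) blast
  obtain N where N: "0 \<le> N" "\<And>s x. x \<in> space S \<Longrightarrow> \<bar>H s x\<bar> \<le> N" by (rule bounded_field_bound[OF assms(2)]) blast
  have "\<bar>G s x + H s x\<bar> \<le> M + N" if "x \<in> space S" for s x
    using M(2)[OF that, of s] N(2)[OF that, of s] by linarith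
  moreover have "(\<lambda>(s, x). G s x + H s x) \<in> borel_measurable (borel \<Otimes>\<^sub>M S)" by measurable
  ultimately show ?thesis unfolding bounded_field_def by blast
qed

lemma bounded_field_mult:
  assumes "bounded_field S G" "bounded_field S H"
  shows "bounded_field S (\<lambda>s x. G s x * H s x)"
proof -
  note [measurable] = bounded_field_measurable[OF assms(1)] bounded_field_measurable[OF assms(2)]
  obtain M where M: "0 \<le> M" "\<And>s x. x \<in> space S \<Longrightarrow> \<bar>G s x\<bar> \<le> M" by (rule bounded_field_bound[OF assms(1)]) blast
  obtain N where N: "0 \<le> N" "\<And>s x. x \<in> space S \<Longrightarrow> \<bar>H s x\<bar> \<le> N" by (rule bounded_field_bound[OF assms(2)]) blast
  have "\<bar>G s x * H s x\<bar> \<le> M * N" if "x \<in> space S" for s x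
    using M(2)[OF that, of s] N(2)[OF that, of s] M(1) unfolding abs_mult by (intro mult_mono) auto
  moreover have "(\<lambda>(s, x). G s x * H s x) \<in> borel_measurable (borel \<Otimes>\<^sub>M S)" by measurable
  ultimately show ?thesis unfolding bounded_field_def by blast
qed

lemma bounded_field_time:
  assumes [measurable]: "a \<in> borel_measurable borel" and "\<And>s. \<bar>a s\<bar> \<le> M"
  shows "bounded_field S (\<lambda>s _. a s)"
  unfolding bounded_field_def using assms(2) by (auto simp: split_beta')

lemma bounded_field_constant: "bounded_field S (\<lambda>_ _. c)"
  by (rule bounded_field_time[where M="\<bar>c\<bar>"]) auto

lemma bounded_field_diff:
  assumes "bounded_field S G" "bounded_field S H"
  shows "bounded_field S (\<lambda>s x. G s x - H s x)"
  using bounded_field_add[OF assms(1) bounded_field_mult[OF bounded_field_constant[of S "-1"] assms(2)]]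
  by simp

text \<open>Later \<open>w s\<close> is known only through a formula that holds on \<open>E\<close>;
  this transfers the regularity of the formula to it.\<close>

lemma bounded_field_cong:
  assumes "bounded_field S G" "\<And>s x. x \<in> space S \<Longrightarrow> G s x = H s x"
  shows "bounded_field S H"
proof -
  have "case_prod H \<in> borel_measurable (borel \<Otimes>\<^sub>M S)"
    using bounded_field_measurable[OF assms(1)]
    by (rule measurable_cong[THEN iffD1, rotated]) (auto simp: space_pair_measure assms(2))
  moreover obtain M where "0 \<le> M" "\<And>s x. x \<in> space S \<Longrightarrow> \<bar>G s x\<bar> \<le> M" by (rule bounded_field_bound[OF assms(1)]) blast
  ultimately show ?thesis unfolding bounded_field_def using assms(2) by metis
qed

lemma bounded_field_at:
  "bounded_field S H \<Longrightarrow> bounded_field S (\<lambda>_. H s)"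
  by (rule bounded_field_comp) simp_all

lemma bounded_field_time_section:
  assumes "bounded_field S H" "x \<in> space S"
  shows "(\<lambda>s. H s x) \<in> borel_measurable borel"
  using measurable_Pair1[OF bounded_field_measurable[OF assms(1)] assms(2)] by simp

lemma bounded_field_set_integrable:
  assumes H: "bounded_field S H" and x: "x \<in> space S"
  shows "set_integrable lborel {a..b} (\<lambda>s. H s x)"
proof -
  note [measurable] = bounded_field_time_section[OF H x]
  obtain M where "0 \<le> M" "\<And>s x. x \<in> space S \<Longrightarrow> \<bar>H s x\<bar> \<le> M" by (rule bounded_field_bound[OF H]) blast
  then show ?thesis using x by (intro set_integrable_bounded_Icc[where M=M]) auto
qed

lemma bounded_field_integral:
  assumes H: "bounded_field S H"
  shows "bounded_field S (\<lambda>_ x. LINT s:{a..b}|lborel. H s x)"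
proof -
  note [measurable] = bounded_field_measurable[OF H]
  obtain M where M: "0 \<le> M" "\<And>s x. x \<in> space S \<Longrightarrow> \<bar>H s x\<bar> \<le> M" by (rule bounded_field_bound[OF H]) blast
  show ?thesis
  proof (rule bounded_field_space)
    have "(\<lambda>(x, s). indicator {a..b} s *\<^sub>R H s x) \<in> borel_measurable (S \<Otimes>\<^sub>M lborel)" by measurable
    then show "(\<lambda>x. LINT s:{a..b}|lborel. H s x) \<in> borel_measurable S"
      unfolding set_lebesgue_integral_def by (rule lborel.borel_measurable_lebesgue_integral)
    fix x assume x: "x \<in> space S"
    have int: "set_integrable lborel {a..b} (\<lambda>s. H s x)" by (rule bounded_field_set_integrable[OF H x])
    have const: "set_integrable lborel {a..b} (\<lambda>s. M)"
      by (rule set_integrable_bounded_Icc[where M=M]) (auto simp: M)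
    have "norm (LINT s:{a..b}|lborel. H s x) \<le> (LINT s:{a..b}|lborel. norm (H s x))"
      by (rule set_integral_norm_bound[OF int])
    also have "\<dots> \<le> (LINT s:{a..b}|lborel. M)"
      using set_integrable_norm[OF int] const M(2)[OF x] by (intro set_integral_mono) auto
    finally show "\<bar>LINT s:{a..b}|lborel. H s x\<bar> \<le> (LINT s:{a..b}|lborel. M)" by simp
  qed
qed

section \<open>Splitting and translating integrals over intervals\<close>

lemma set_integral_singleton: "(LINT s:{a}|lborel. g s) = (0::real)" for a :: real
proof -
  have "AE s in lborel. indicator {a} s *\<^sub>R g s = 0"
    using AE_lborel_singleton[of a] by eventually_elim (simp add: indicator_def)
  then show ?thesis unfolding set_lebesgue_integral_def by (rule integral_eq_zero_AE)
qed

lemma set_integral_Icc_split: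
  fixes a :: "real \<Rightarrow> real"
  assumes a: "set_integrable lborel {l..t} a" and "l \<le> s" "s \<le> t"
  shows "(LINT q:{l..t}|lborel. a q) = (LINT q:{l..s}|lborel. a q) + (LINT q:{s..t}|lborel. a q)"
proof -
  have 1: "set_integrable lborel {l..s} a" and 2: "set_integrable lborel {s..t} a"
    using assms by (auto intro: set_integrable_subset[OF a])
  have "AE q in lborel. indicator {l..t} q *\<^sub>R a q = indicator {l..s} q *\<^sub>R a q + indicator {s..t} q *\<^sub>R a q"
    using AE_lborel_singleton[of s] by eventually_elim (use assms in \<open>auto simp: indicator_def\<close>)
  then have "(LINT q:{l..t}|lborel. a q) = (\<integral>q. indicator {l..s} q *\<^sub>R a q + indicator {s..t} q *\<^sub>R a q \<partial>lborel)"
    using a 1 2 unfolding set_integrable_def set_lebesgue_integral_def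
    by (intro integral_cong_AE borel_measurable_add) auto
  then show ?thesis
    using 1 2 unfolding set_integrable_def set_lebesgue_integral_def by simp
qed

lemma set_integral_Icc_translate:
  fixes a :: "real \<Rightarrow> real"
  shows "(LINT r:{0..t-s}|lborel. a (s + r)) = (LINT q:{s..t}|lborel. a q)"
  unfolding set_lebesgue_integral_def
  by (subst lborel_integral_real_affine[of 1 _ s], simp)
    (auto simp: indicator_def intro!: Bochner_Integration.integral_cong)

lemma Cb_bounded_field:
  assumes "f \<in> Cb E"
  shows "bounded_field (borel_on E) (\<lambda>_. f)"
proof -
  obtain M where "\<And>x. x \<in> E \<Longrightarrow> \<bar>f x\<bar> \<le> M"
    using assms unfolding Cb_def bounded_real by auto
  then show ?thesis
    using assms by (intro bounded_field_space[where M=M])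
      (auto simp: Cb_def intro: borel_measurable_continuous_on_restrict)
qed

section \<open>Mild equations and positivity\<close>

context cadlag_markov
begin

lemma evolve_cong:
  assumes "x \<in> E" "\<And>y. y \<in> E \<Longrightarrow> f y = g y"
  shows "evolve P s f x = evolve P s g x"
  unfolding evolve_def using assms path_in by (intro Bochner_Integration.integral_cong) auto

lemma evolve_const: "x \<in> E \<Longrightarrow> evolve P s (\<lambda>_. c) x = c"
  using prob_space.prob_space[OF prob_space_P] by (simp add: evolve_def)

text \<open>A function given by a mild formula has measurable and bounded time slices, so the lemmas
  below can derive this for \<open>w\<close> from its equation.\<close>

lemma bounded_field_mild:
  assumes f: "bounded_field (borel_on E) (\<lambda>_. f)" and G: "bounded_field (borel_on E) G"
  shows "bounded_field (borel_on E) (\<lambda>_ y. evolve P t f y - (LINT r:{0..t}|lborel. evolve P r (G (t - r)) y))"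
proof (rule bounded_field_diff)
  show "bounded_field (borel_on E) (\<lambda>_. evolve P t f)"
    using bounded_field_at[OF bounded_field_evolve[OF f]] .
  have "bounded_field (borel_on E) (\<lambda>r. evolve P r (G (t - r)))"
    by (intro bounded_field_evolve bounded_field_comp[OF G]) simp
  then show "bounded_field (borel_on E) (\<lambda>_ y. LINT r:{0..t}|lborel. evolve P r (G (t - r)) y)"
    by (rule bounded_field_integral)
qed

text \<open>Duhamel's formula with killing at rate \<open>K\<close>: the mild form of dw/dt = Lw - G
  is rewritten as the mild form of dw/dt = (L - K)w + (Kw - G).\<close>

lemma mild_exponential:
  assumes x: "x \<in> E" and t: "0 \<le> t"
    and f: "bounded_field (borel_on E) (\<lambda>_. f)" and G: "bounded_field (borel_on E) G"
    and w: "\<And>s y. 0 \<le> s \<Longrightarrow> s \<le> t \<Longrightarrow> y \<in> E \<Longrightarrow>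
      w s y = evolve P s f y - (LINT r:{0..s}|lborel. evolve P r (G (s - r)) y)"
  shows "set_integrable lborel {0..t} (\<lambda>s. exp (- K * s) * (evolve P s (\<lambda>y. K * w (t - s) y - G (t - s) y) x))"
    and "w t x = exp (- K * t) * evolve P t f x
      + (LINT s:{0..t}|lborel. exp (- K * s) * (evolve P s (\<lambda>y. K * w (t - s) y - G (t - s) y) x))"
proof -
  \<comment> \<open>\<open>B\<close> interpolates between \<open>w t x\<close> at \<open>0\<close>
    and \<open>evolve P t f x\<close> at \<open>t\<close>; by the semigroup property it is a
    primitive with density \<open>a\<close>.\<close>
  define a where "a q = evolve P q (G (t - q)) x" for q
  define B where "B s = evolve P s (w (t - s)) x" for s
  have G': "bounded_field (borel_on E) (\<lambda>q. evolve P q (G (t - q)))"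
    by (intro bounded_field_evolve bounded_field_comp[OF G]) simp
  have a_meas: "a \<in> borel_measurable borel"
    unfolding a_def using bounded_field_time_section[OF G'] x by simp
  obtain M where "0 \<le> M" "\<And>q y. y \<in> E \<Longrightarrow> \<bar>evolve P q (G (t - q)) y\<bar> \<le> M"
    by (rule bounded_field_bound[OF G', unfolded space_borel_on]) blast
  then have a_bound: "\<bar>a q\<bar> \<le> M" for q using x by (simp add: a_def)
  have w_field: "bounded_field (borel_on E) (\<lambda>_. w s)" if "0 \<le> s" "s \<le> t" for s
    using bounded_field_mild[OF f G] by (rule bounded_field_cong) (simp add: w[OF that])
  have B: "B s = evolve P t f x - (LINT q:{s..t}|lborel. a q)" if s: "s \<in> {0..t}" for s
  proof -
    have Gs: "bounded_field (borel_on E) (\<lambda>r. evolve P r (G (t - s - r)))"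
      by (intro bounded_field_evolve bounded_field_comp[OF G]) simp
    have "B s = evolve P s (\<lambda>y. evolve P (t - s) f y - (LINT r:{0..t-s}|lborel. evolve P r (G (t - s - r)) y)) x"
      unfolding B_def using s by (intro evolve_cong[OF x] w) auto
    also have "\<dots> = evolve P s (evolve P (t - s) f) x
        - evolve P s (\<lambda>y. LINT r:{0..t-s}|lborel. evolve P r (G (t - s - r)) y) x"
      by (intro evolve_diff[OF x] bounded_field_integral[OF Gs] bounded_field_at[OF bounded_field_evolve[OF f]])
    also have "evolve P s (evolve P (t - s) f) x = evolve P t f x"
      using s evolve_evolve[OF x _ _ f, of s "t - s"] by simp
    also have "evolve P s (\<lambda>y. LINT r:{0..t-s}|lborel. evolve P r (G (t - s - r)) y) x
        = (LINT r:{0..t-s}|lborel. evolve P s (evolve P r (G (t - s - r))) x)"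
      by (rule evolve_integral[OF x Gs])
    also have "\<dots> = (LINT r:{0..t-s}|lborel. a (s + r))"
      using s evolve_evolve[OF x _ _ bounded_field_at[OF G], of s _ "t - s - _"]
      by (intro set_lebesgue_integral_cong) (auto simp: a_def diff_diff_eq)
    finally show ?thesis by (simp only: set_integral_Icc_translate)
  qed
  \<comment> \<open>The new integrand is minus the derivative of exp(- K s) \<open>B s\<close>, with
    \<open>a\<close> in the role of the derivative of \<open>B\<close>.\<close>
  have eq: "exp (- K * s) * (evolve P s (\<lambda>y. K * w (t - s) y - G (t - s) y) x)
     = - (exp (- K * s) * a s + - K * exp (- K * s) * B s)" if s: "s \<in> {0..t}" for s
  proof -
    have "evolve P s (\<lambda>y. K * w (t - s) y - G (t - s) y) x = evolve P s (\<lambda>y. K * w (t - s) y) x - evolve P s (G (t - s)) x"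
      using s by (intro evolve_diff[OF x] bounded_field_mult bounded_field_constant w_field bounded_field_at[OF G]) auto
    then have "evolve P s (\<lambda>y. K * w (t - s) y - G (t - s) y) x = K * B s - a s"
      by (simp only: evolve_cmult a_def B_def)
    then show ?thesis by (simp only:) (simp add: algebra_simps)
  qed
  have deriv: "((\<lambda>s. exp (- K * s)) has_real_derivative - K * exp (- K * s)) (at s)" for s
    by (auto intro!: derivative_eq_intros)
  have cont: "continuous_on {0..t} (\<lambda>s. - K * exp (- K * s))"
    by (intro continuous_intros)
  note ibp = integration_by_parts_primitive[OF t a_meas a_bound deriv cont B]
  show "set_integrable lborel {0..t} (\<lambda>s. exp (- K * s) * (evolve P s (\<lambda>y. K * w (t - s) y - G (t - s) y) x))"
    using set_integrable_mult_right[of "-1", OF ibp(1)]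
    by (subst set_integrable_cong[OF refl refl eq]) auto
  have "(LINT s:{0..t}|lborel. exp (- K * s) * (evolve P s (\<lambda>y. K * w (t - s) y - G (t - s) y) x))
      = (LINT s:{0..t}|lborel. - (exp (- K * s) * a s + - K * exp (- K * s) * B s))"
    using eq by (intro set_lebesgue_integral_cong) auto
  also have "\<dots> = - (LINT s:{0..t}|lborel. exp (- K * s) * a s + - K * exp (- K * s) * B s)"
    unfolding set_lebesgue_integral_def scaleR_minus_right by (rule Bochner_Integration.integral_minus)
  also have "\<dots> = B 0 - exp (- K * t) * evolve P t f x"
    using ibp(2) by simp
  also have "B 0 = w t x"
  proof -
    have "B 0 = evolve P t f x - (LINT q:{0..t}|lborel. a q)" using B t by simp
    also have "\<dots> = w t x" using w[of t x] t x by (simp add: a_def)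
    finally show ?thesis .
  qed
  finally show "w t x = exp (- K * t) * evolve P t f x
      + (LINT s:{0..t}|lborel. exp (- K * s) * (evolve P s (\<lambda>y. K * w (t - s) y - G (t - s) y) x))"
    by linarith
qed

text \<open>The exponential weight turns the zeroth-order term \<open>K w - G\<close> into a source that is bounded
  below by the negative part of \<open>w\<close>; a Gronwall iteration then kills that negative part.\<close>

lemma mild_nonneg:
  assumes K: "0 < K" and f: "bounded_field (borel_on E) (\<lambda>_. f)" and f_nonneg: "\<And>y. y \<in> E \<Longrightarrow> 0 \<le> f y"
    and G: "bounded_field (borel_on E) G"
    and w: "\<And>s y. 0 \<le> s \<Longrightarrow> s \<le> T \<Longrightarrow> y \<in> E \<Longrightarrow>
      w s y = evolve P s f y - (LINT r:{0..s}|lborel. evolve P r (G (s - r)) y)"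
    and M: "0 \<le> M" "\<And>s y. 0 \<le> s \<Longrightarrow> s \<le> T \<Longrightarrow> y \<in> E \<Longrightarrow> - M \<le> w s y"
    and source: "\<And>s y. 0 \<le> s \<Longrightarrow> s \<le> T \<Longrightarrow> y \<in> E \<Longrightarrow> - (2 * K * max 0 (- w s y)) \<le> K * w s y - G s y"
    and t: "0 \<le> t" "t \<le> T" and x: "x \<in> E"
  shows "0 \<le> w t x"
proof -
  have w_field: "bounded_field (borel_on E) (\<lambda>_. w s)" if "0 \<le> s" "s \<le> T" for s
    using bounded_field_mild[OF f G] by (rule bounded_field_cong) (simp add: w[OF that])
  \<comment> \<open>Each round halves the constant: the integral of 2 K c exp(4 K (s - r)) over r in
    [0, s] is (c/2)(exp(4 K s) - 1). This is why the rate is \<open>4 * K\<close> against the factor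
    \<open>2 * K\<close> in the source condition.\<close>
  have iter: "- (M / 2 ^ n * exp (4 * K * s)) \<le> w s y" if "0 \<le> s" "s \<le> T" "y \<in> E" for n s y
    using that
  proof (induction n arbitrary: s y)
    case 0
    have "M * 1 \<le> M * exp (4 * K * s)"
      using M(1) K 0(1) by (intro mult_left_mono) auto
    then show ?case using M(2)[OF 0] by simp
  next
    case (Suc n)
    let ?c = "M / 2 ^ n"
    have c: "0 \<le> ?c" using M(1) by simp
    note mild = mild_exponential[OF Suc.prems(3) Suc.prems(1) f G w, of K]
    \<comment> \<open>The induction hypothesis controls the negative part of the slice at
      \<open>s - r\<close>. Averaging over the motion preserves this lower bound, and a weight in
      (0, 1] cannot worsen a nonpositive one.\<close>
    have low: "- (2 * K * ?c * exp (4 * K * (s - r)))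
        \<le> exp (- K * r) * (evolve P r (\<lambda>y. K * w (s - r) y - G (s - r) y) y)" if r: "r \<in> {0..s}" for r
    proof -
      let ?b = "2 * K * (?c * exp (4 * K * (s - r)))"
      have sr: "0 \<le> s - r" "s - r \<le> T" using r Suc.prems by auto
      have b: "0 \<le> ?b" using c K by (intro mult_nonneg_nonneg) auto
      have "- ?b \<le> evolve P r (\<lambda>y. K * w (s - r) y - G (s - r) y) y"
      proof (rule evolve_ge[OF Suc.prems(3)])
        show "bounded_field (borel_on E) (\<lambda>_ y. K * w (s - r) y - G (s - r) y)"
          by (intro bounded_field_diff bounded_field_mult bounded_field_constant w_field[OF sr] bounded_field_at[OF G])
        fix z assume z: "z \<in> E"
        have "max 0 (- w (s - r) z) \<le> ?c * exp (4 * K * (s - r))"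
          using Suc.IH[OF sr z] mult_nonneg_nonneg[OF c exp_ge_zero[of "4 * K * (s - r)"]] by linarith
        then have "2 * K * max 0 (- w (s - r) z) \<le> ?b"
          using K by (intro mult_left_mono) auto
        then show "- ?b \<le> K * w (s - r) z - G (s - r) z"
          using source[OF sr z] by linarith
      qed
      then have "exp (- K * r) * - ?b \<le> exp (- K * r) * evolve P r (\<lambda>y. K * w (s - r) y - G (s - r) y) y"
        by (intro mult_left_mono) auto
      moreover have "exp (- K * r) * ?b \<le> 1 * ?b"
        using b K r by (intro mult_right_mono) auto
      ultimately show ?thesis by (simp add: mult.assoc)
    qed
    let ?h = "\<lambda>r. ?c / 2 * exp (4 * K * (s - r))"
    have cont: "continuous_on {0..s} (\<lambda>r. - (2 * K * ?c * exp (4 * K * (s - r))))"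
      by (intro continuous_intros)
    have "(LINT r:{0..s}|lborel. - (2 * K * ?c * exp (4 * K * (s - r)))) = ?h s - ?h 0"
      using Suc.prems(1) cont by (intro set_integral_FTC_Icc) (auto intro!: derivative_eq_intros)
    moreover have "(LINT r:{0..s}|lborel. - (2 * K * ?c * exp (4 * K * (s - r))))
       \<le> (LINT r:{0..s}|lborel. exp (- K * r) * (evolve P r (\<lambda>y. K * w (s - r) y - G (s - r) y) y))"
      using low Suc.prems
      by (intro set_integral_mono mild(1) set_integrable_continuous_Icc[OF cont]) auto
    moreover have "0 \<le> exp (- K * s) * evolve P s f y"
      using evolve_ge[OF Suc.prems(3) f f_nonneg] by simp
    ultimately have "?h s - ?h 0 \<le> w s y"
      using mild(2) Suc.prems by simp
    moreover have "- ?h 0 \<le> ?h s - ?h 0" using c by simp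
    ultimately show ?case by (simp add: field_simps)
  qed
  have "(\<lambda>n. - (M * exp (4 * K * t) * (1 / 2) ^ n)) \<longlonglongrightarrow> - (M * exp (4 * K * t) * 0)"
    by (intro tendsto_intros LIMSEQ_power_zero) simp
  then show ?thesis
    using iter[OF t x] by (intro LIMSEQ_le_const2[where X="\<lambda>n. - (M * exp (4 * K * t) * (1 / 2) ^ n)"])
      (auto simp: field_simps)
qed

end

section \<open>The supersolution\<close>

lemma martingale_expectation:
  assumes "prob_space M" and sub: "subalgebra M (F 0)" and Z: "martingale M F Z" and t: "0 \<le> t"
  shows "(\<integral>\<omega>. Z t \<omega> \<partial>M) = (\<integral>\<omega>. Z 0 \<omega> \<partial>M)"
proof -
  interpret prob_space M by fact
  interpret finite_measure_subalgebra M "F 0" by standard (rule sub)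
  have "integrable M (Z t)" "integrable M (Z 0)"
    and ae: "AE \<omega> in M. real_cond_exp M (F 0) (Z t) \<omega> = Z 0 \<omega>"
    using Z t by (auto simp: martingale_def)
  then have "(\<integral>\<omega>. Z t \<omega> \<partial>M) = (\<integral>\<omega>. real_cond_exp M (F 0) (Z t) \<omega> \<partial>M)"
    using real_cond_exp_int(2) by simp
  also have "\<dots> = (\<integral>\<omega>. Z 0 \<omega> \<partial>M)"
    using ae \<open>integrable M (Z 0)\<close> by (intro integral_cong_AE) auto
  finally show ?thesis .
qed

lemma generator_Dom:
  assumes "f \<in> Dom E P"
  shows "generator E P f \<in> Cb E" "solves_martingale_problem E P f (generator E P f)"
  using someI_ex[of "\<lambda>g. g \<in> Cb E \<and> solves_martingale_problem E P f g"] assms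
  unfolding generator_def Dom_def by blast+

section \<open>Dynkin's formula and time-dependent multiples of a domain function\<close>

context cadlag_markov
begin

text \<open>The definition of \<open>martingale\<close> does not contain this inclusion, which gives
  the conditional expectations their defining property.\<close>

lemma subalgebra_natural_filtration:
  assumes x: "x \<in> E" and "0 \<le> t"
  shows "subalgebra (P x) (natural_filtration (borel_on E) (cadlag_paths E) t)"
proof -
  have "(\<lambda>\<omega>. restrict \<omega> {0..t}) \<in> W \<rightarrow>\<^sub>M Pi\<^sub>M {0..t} (\<lambda>_. borel_on E)"
    by (rule measurable_restrict) (rule measurable_path_eval, simp)
  then have "sets (natural_filtration (borel_on E) (cadlag_paths E) t) \<subseteq> sets W"
    unfolding natural_filtration_def by (rule sets_image_in_sets[OF space_cadlag_paths])
  then show ?thesis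
    by (simp add: subalgebra_def space_P[OF x] sets_P[OF x]) (simp add: natural_filtration_def)
qed

lemma AE_start: "x \<in> E \<Longrightarrow> AE \<omega> in P x. \<omega> 0 = x"
  by (rule markov[unfolded markov_family_def space_borel_on, THEN conjunct2, THEN conjunct1, rule_format])

text \<open>The process in the martingale problem vanishes almost surely at time 0, because paths
  start at \<open>x\<close>, and so has mean 0 at every time. Fubini then moves the expectation
  inside the time integral.\<close>

lemma Dynkin:
  assumes f: "f \<in> Dom E P" and x: "x \<in> E" and t: "0 \<le> t"
  shows "evolve P t f x = f x + (LINT s:{0..t}|lborel. evolve P s (generator E P f) x)"
proof -
  interpret prob_space "P x" by (rule prob_space_P[OF x])
  let ?g = "generator E P f"
  let ?Z = "\<lambda>t \<omega>. f (\<omega> t) - f x - (LINT s:{0..t}|lborel. ?g (\<omega> s))"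
  have f_field: "bounded_field (borel_on E) (\<lambda>_. f)" and g_field: "bounded_field (borel_on E) (\<lambda>_. ?g)"
    using f generator_Dom(1)[OF f] by (auto simp: Dom_def intro: Cb_bounded_field)
  have mart: "martingale (P x) (natural_filtration (borel_on E) (cadlag_paths E)) ?Z"
    using generator_Dom(2)[OF f] x unfolding solves_martingale_problem_def by blast
  have Z_int: "integrable (P x) (?Z t)"
    using mart t unfolding martingale_def by blast
  have "(\<integral>\<omega>. ?Z t \<omega> \<partial>P x) = (\<integral>\<omega>. ?Z 0 \<omega> \<partial>P x)"
    by (rule martingale_expectation[OF prob_space_axioms subalgebra_natural_filtration[OF x] mart t]) simp
  also have "\<dots> = (\<integral>\<omega>. 0 \<partial>P x)"
  proof (rule Bochner_Integration.integral_cong_AE)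
    show "?Z 0 \<in> borel_measurable (P x)"
      using mart unfolding martingale_def by (blast intro: borel_measurable_integrable)
    show "AE \<omega> in P x. ?Z 0 \<omega> = 0"
      using AE_start[OF x] by (rule eventually_mono) (simp add: set_integral_singleton)
  qed simp
  finally have Z0: "(\<integral>\<omega>. ?Z t \<omega> \<partial>P x) = 0" by simp
  obtain M where M: "0 \<le> M" "\<And>y. y \<in> E \<Longrightarrow> \<bar>f y\<bar> \<le> M"
    by (rule bounded_field_bound[OF f_field, unfolded space_borel_on]) blast
  have f_int: "integrable (P x) (\<lambda>\<omega>. f (\<omega> t))"
    using measurable_compose[OF measurable_path_eval[OF t] bounded_field_section[OF f_field]]
    by (intro integrable_P[OF x, where M=M] M) (auto simp: cadlag_paths_in t)
  then have fx_int: "integrable (P x) (\<lambda>\<omega>. f (\<omega> t) - f x)" by simp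
  \<comment> \<open>Integrability of the time integral comes from writing it as the difference of
    two integrable terms, the increment of \<open>f\<close> and the martingale itself.\<close>
  have "integrable (P x) (\<lambda>\<omega>. (f (\<omega> t) - f x) - ?Z t \<omega>)"
    by (rule Bochner_Integration.integrable_diff[OF fx_int Z_int])
  then have g_int: "integrable (P x) (\<lambda>\<omega>. LINT s:{0..t}|lborel. ?g (\<omega> s))" by simp
  have "0 = (\<integral>\<omega>. f (\<omega> t) - f x \<partial>P x) - (\<integral>\<omega>. (LINT s:{0..t}|lborel. ?g (\<omega> s)) \<partial>P x)"
    using Z0 Bochner_Integration.integral_diff[OF fx_int g_int] by simp
  also have "(\<integral>\<omega>. f (\<omega> t) - f x \<partial>P x) = evolve P t f x - f x"
    using f_int t by (simp add: evolve_def prob_space)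
  also have "(\<integral>\<omega>. (LINT s:{0..t}|lborel. ?g (\<omega> s)) \<partial>P x) = (LINT s:{0..t}|lborel. evolve P s ?g x)"
    by (rule integral_path_Fubini[OF x g_field]) simp
  finally show ?thesis by simp
qed

text \<open>Integration by parts for the weight 1/(c (t - s) + d) times
  \<open>evolve P s \<phi> x\<close>, where Dynkin's formula supplies the density of the second
  factor. The source is the generator applied in space minus the derivative in time, hence the two
  terms.\<close>

lemma mild_time_scaling:
  fixes c d :: real
  assumes \<phi>: "\<phi> \<in> Dom E P" and x: "x \<in> E" and t: "0 \<le> t" and c: "0 \<le> c" and d: "0 < d"
  shows "\<phi> x / (c * t + d) = evolve P t \<phi> x / d - (LINT s:{0..t}|lborel.
    evolve P s (\<lambda>y. generator E P \<phi> y / (c * (t - s) + d) + c * \<phi> y / (c * (t - s) + d)\<^sup>2) x)"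
proof -
  let ?g = "generator E P \<phi>" and ?k = "\<lambda>s. inverse (c * (t - s) + d)"
  define a where "a q = evolve P q ?g x" for q
  have \<phi>_field: "bounded_field (borel_on E) (\<lambda>_. \<phi>)" and g_field: "bounded_field (borel_on E) (\<lambda>_. ?g)"
    using \<phi> generator_Dom(1)[OF \<phi>] by (auto simp: Dom_def intro: Cb_bounded_field)
  have a_field: "bounded_field (borel_on E) (\<lambda>q. evolve P q ?g)" by (rule bounded_field_evolve[OF g_field])
  have a_meas: "a \<in> borel_measurable borel"
    unfolding a_def using bounded_field_time_section[OF a_field] x by simp
  obtain M where "0 \<le> M" "\<And>q y. y \<in> E \<Longrightarrow> \<bar>evolve P q ?g y\<bar> \<le> M"
    by (rule bounded_field_bound[OF a_field, unfolded space_borel_on]) blast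
  then have a_bound: "\<bar>a q\<bar> \<le> M" for q using x by (simp add: a_def)
  have pos: "0 < c * (t - s) + d" if "s \<in> {0..t}" for s
    using that c d by (intro add_nonneg_pos mult_nonneg_nonneg) auto
  have B: "evolve P s \<phi> x = evolve P t \<phi> x - (LINT q:{s..t}|lborel. a q)" if s: "s \<in> {0..t}" for s
    using Dynkin[OF \<phi> x, of s] Dynkin[OF \<phi> x, of t] s
      set_integral_Icc_split[OF bounded_field_set_integrable[OF a_field, of x 0 t], of s] x
    by (simp add: a_def)
  \<comment> \<open>The equation g' = - c g^2 with time reversed, hence the positive sign.\<close>
  have deriv: "(?k has_real_derivative c * (?k s)\<^sup>2) (at s)" if "s \<in> {0..t}" for s
    using pos[OF that] by (auto intro!: derivative_eq_intros simp: power2_eq_square)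
  have cont: "continuous_on {0..t} (\<lambda>s. c * (?k s)\<^sup>2)"
    using pos by (intro continuous_intros) (auto simp: less_imp_neq[symmetric])
  have split: "evolve P s (\<lambda>y. ?g y / (c * (t - s) + d) + c * \<phi> y / (c * (t - s) + d)\<^sup>2) x
      = ?k s * a s + (c * (?k s)\<^sup>2) * evolve P s \<phi> x" for s
  proof -
    have "evolve P s (\<lambda>y. ?g y / (c * (t - s) + d) + c * \<phi> y / (c * (t - s) + d)\<^sup>2) x
      = evolve P s (\<lambda>y. ?k s * ?g y - (- (c * (?k s)\<^sup>2)) * \<phi> y) x"
      by (simp add: divide_inverse power_inverse mult_ac)
    also have "\<dots> = evolve P s (\<lambda>y. ?k s * ?g y) x - evolve P s (\<lambda>y. (- (c * (?k s)\<^sup>2)) * \<phi> y) x"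
      by (intro evolve_diff[OF x] bounded_field_mult bounded_field_constant \<phi>_field g_field)
    finally show ?thesis unfolding evolve_cmult a_def by simp
  qed
  have "evolve P 0 \<phi> x = \<phi> x"
    using Dynkin[OF \<phi> x, of 0] by (simp add: set_integral_singleton)
  then show ?thesis
    using integration_by_parts_primitive(2)[OF t a_meas a_bound deriv cont B]
    unfolding split by (simp add: divide_inverse mult.commute)
qed

text \<open>Since \<open>\<L> \<phi> = (\<beta> - l) \<phi>\<close> with \<open>l \<ge> 0\<close>, the function \<open>\<phi> x / (c t + d)\<close> with
  \<open>c \<le> \<alpha> \<phi>\<close> is a supersolution of \<open>\<partial>\<^sub>t u = \<L> u - \<psi>(u)\<close>.\<close>

lemma cumulant_solution_le:
  fixes c d l \<theta> :: real
  assumes u: "cumulant_solution E P \<beta> \<alpha> (\<lambda>_. \<theta>) (\<lambda>_. 0) u"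
    and \<beta>: "\<beta> \<in> Cb E" and \<alpha>: "\<alpha> \<in> Cb E" "\<And>y. y \<in> E \<Longrightarrow> 0 \<le> \<alpha> y"
    and \<phi>: "\<phi> \<in> positive_harmonic E P \<beta> l" and l: "0 \<le> l"
    and c: "0 \<le> c" "\<And>y. y \<in> E \<Longrightarrow> c \<le> \<alpha> y * \<phi> y"
    and d: "0 < d" "\<And>y. y \<in> E \<Longrightarrow> d * \<theta> \<le> \<phi> y"
    and t: "0 \<le> t" and x: "x \<in> E"
  shows "u t x \<le> \<phi> x / (c * t + d)"
proof -
  let ?g = "generator E P \<phi>"
  have \<phi>_Dom: "\<phi> \<in> Dom E P" and \<phi>_pos: "\<And>y. y \<in> E \<Longrightarrow> 0 < \<phi> y"
    and g: "\<And>y. y \<in> E \<Longrightarrow> ?g y = \<beta> y * \<phi> y - l * \<phi> y"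
    using \<phi> by (auto simp: positive_harmonic_def algebra_simps)
  have u_meas: "(\<lambda>(t, x). u t x) \<in> borel_measurable (borel_on {0..} \<Otimes>\<^sub>M borel_on E)"
    and u_nonneg: "\<And>s y. 0 \<le> s \<Longrightarrow> y \<in> E \<Longrightarrow> 0 \<le> u s y"
    and u_bounded: "bounded ((\<lambda>(t, x). u t x) ` ({0..t} \<times> E))"
    and u_eq: "\<And>s y. 0 \<le> s \<Longrightarrow> y \<in> E \<Longrightarrow>
        u s y + (\<integral>\<omega>. (LINT r:{0..s}|lborel. \<psi> \<beta> \<alpha> (\<omega> r) (u (s - r) (\<omega> r))) \<partial>P y)
          = (\<integral>\<omega>. \<theta> + (LINT r:{0..s}|lborel. 0) \<partial>P y)"
    using u unfolding cumulant_solution_def by auto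
  obtain N where "\<forall>z\<in>{0..t} \<times> E. \<bar>case_prod u z\<bar> \<le> N"
    using u_bounded unfolding bounded_real by (auto simp: image_iff)
  then have N: "\<bar>u s y\<bar> \<le> N" if "0 \<le> s" "s \<le> t" "y \<in> E" for s y
    using that by force
  have N0: "0 \<le> N" using N[of 0 x] t x by linarith
  \<comment> \<open>\<open>u\<close> is measurable only for nonnegative times and bounded only on
    bounded time intervals. Extending it by \<open>0\<close> outside \<open>{0..t}\<close> makes it
    a bounded field, without changing the values that enter the equation up to
    \<open>t\<close>.\<close>
  define v where "v s y = indicator {0..t} s * u (max 0 s) y" for s y
  have v: "v s y = u s y" if "0 \<le> s" "s \<le> t" for s y
    using that by (simp add: v_def)
  have v_field: "bounded_field (borel_on E) v"
  proof -
    have m: "max 0 \<in> borel \<rightarrow>\<^sub>M borel_on {0::real..}"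
      by (rule measurable_restrict_space2) (auto simp: le_max_iff_disj intro!: borel_measurable_max)
    have "(\<lambda>z. (max 0 (fst z), snd z)) \<in> borel \<Otimes>\<^sub>M borel_on E \<rightarrow>\<^sub>M borel_on {0::real..} \<Otimes>\<^sub>M borel_on E"
      by (intro measurable_Pair measurable_snd measurable_compose[OF measurable_fst m])
    from measurable_compose[OF this u_meas]
    have [measurable]: "(\<lambda>z. u (max 0 (fst z)) (snd z)) \<in> borel_measurable (borel \<Otimes>\<^sub>M borel_on E)"
      by simp
    have "(\<lambda>z. indicator {0..t} (fst z) * u (max 0 (fst z)) (snd z)) \<in> borel_measurable (borel \<Otimes>\<^sub>M borel_on E)"
      by (intro borel_measurable_times measurable_compose[OF measurable_fst]) simp_all
    then have "case_prod v \<in> borel_measurable (borel \<Otimes>\<^sub>M borel_on E)"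
      by (simp add: v_def split_beta')
    moreover have "\<bar>v s y\<bar> \<le> N" if "y \<in> E" for s y
      using N that N0 by (auto simp: v_def indicator_def)
    ultimately show ?thesis unfolding bounded_field_def space_borel_on by blast
  qed
  have \<alpha>_field: "bounded_field (borel_on E) (\<lambda>_. \<alpha>)" and \<beta>_field: "bounded_field (borel_on E) (\<lambda>_. \<beta>)"
    and \<phi>_field: "bounded_field (borel_on E) (\<lambda>_. \<phi>)" and g_field: "bounded_field (borel_on E) (\<lambda>_. ?g)"
    using \<alpha> \<beta> \<phi>_Dom generator_Dom(1)[OF \<phi>_Dom] by (auto simp: Dom_def intro: Cb_bounded_field)
  obtain A where A: "0 \<le> A" "\<And>y. y \<in> E \<Longrightarrow> \<bar>\<alpha> y\<bar> \<le> A"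
    by (rule bounded_field_bound[OF \<alpha>_field, unfolded space_borel_on]) blast
  obtain B where B: "0 \<le> B" "\<And>y. y \<in> E \<Longrightarrow> \<bar>\<beta> y\<bar> \<le> B"
    by (rule bounded_field_bound[OF \<beta>_field, unfolded space_borel_on]) blast
  obtain C where C: "0 \<le> C" "\<And>y. y \<in> E \<Longrightarrow> \<bar>\<phi> y\<bar> \<le> C"
    by (rule bounded_field_bound[OF \<phi>_field, unfolded space_borel_on]) blast
  \<comment> \<open>Cutting time off at \<open>0\<close> keeps the factor of the supersolution
    between \<open>0\<close> and \<open>inverse d\<close> on the whole line.\<close>
  define k where "k s = inverse (c * max 0 s + d)" for s
  have k_denom: "d \<le> c * max 0 s + d" for s using c(1) by simp
  have k_pos: "0 < k s" and k_le: "k s \<le> inverse d" for s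
    using k_denom[of s] d(1) by (auto simp: k_def intro: le_imp_inverse_le)
  have k_field: "bounded_field (borel_on E) (\<lambda>s _. k s)"
  proof (rule bounded_field_time)
    show "k \<in> borel_measurable borel" unfolding k_def by measurable
    show "\<bar>k s\<bar> \<le> inverse d" for s using k_pos[of s] k_le[of s] by linarith
  qed
  \<comment> \<open>\<open>Gu\<close> is \<open>\<psi>\<close> applied to the solution, with the
    square as a product so that the closure lemmas apply. \<open>G\<close> is the source of the
    supersolution minus \<open>Gu\<close>; hence the difference \<open>w\<close> satisfies a mild
    equation with source \<open>G\<close>.\<close>
  define Gu where "Gu s y = \<beta> y * v s y + \<alpha> y * (v s y * v s y)" for s y
  define G where "G s y = (k s * ?g y + c * (k s * k s) * \<phi> y) - Gu s y" for s y
  have Gu_field: "bounded_field (borel_on E) Gu"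
    unfolding Gu_def
    by (intro bounded_field_add bounded_field_mult \<beta>_field \<alpha>_field v_field)
  have GU_field: "bounded_field (borel_on E) (\<lambda>s y. k s * ?g y + c * (k s * k s) * \<phi> y)"
    by (intro bounded_field_add bounded_field_mult \<phi>_field g_field k_field bounded_field_constant)
  have G_field: "bounded_field (borel_on E) G"
    unfolding G_def by (rule bounded_field_diff[OF GU_field Gu_field])
  define f where "f y = \<phi> y / d - \<theta>" for y
  have f_eq: "f = (\<lambda>y. inverse d * \<phi> y - \<theta>)"
    by (auto simp: f_def divide_inverse)
  have f_field: "bounded_field (borel_on E) (\<lambda>_. f)"
    unfolding f_eq
    by (intro bounded_field_diff bounded_field_mult \<phi>_field bounded_field_constant)
  define w where "w s y = k s * \<phi> y - u s y" for s y
  have u_mild: "u s y = \<theta> - (LINT r:{0..s}|lborel. evolve P r (Gu (s - r)) y)"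
    if s: "0 \<le> s" "s \<le> t" and y: "y \<in> E" for s y
  proof -
    have "(\<integral>\<omega>. (LINT r:{0..s}|lborel. \<psi> \<beta> \<alpha> (\<omega> r) (u (s - r) (\<omega> r))) \<partial>P y)
        = (\<integral>\<omega>. (LINT r:{0..s}|lborel. Gu (s - r) (\<omega> r)) \<partial>P y)"
      using s by (intro Bochner_Integration.integral_cong set_lebesgue_integral_cong)
        (auto simp: \<psi>_def Gu_def v power2_eq_square)
    also have "\<dots> = (LINT r:{0..s}|lborel. evolve P r (Gu (s - r)) y)"
      by (rule integral_path_Fubini[OF y bounded_field_comp[OF Gu_field]]) simp_all
    finally show ?thesis
      using u_eq[OF s(1) y] prob_space.prob_space[OF prob_space_P[OF y]]
      by (simp add: set_lebesgue_integral_def)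
  qed
  have w_mild: "w s y = evolve P s f y - (LINT r:{0..s}|lborel. evolve P r (G (s - r)) y)"
    if s: "0 \<le> s" "s \<le> t" and y: "y \<in> E" for s y
  proof -
    have fs: "evolve P s f y = evolve P s \<phi> y / d - \<theta>"
      using evolve_diff[OF y bounded_field_mult[OF bounded_field_constant \<phi>_field] bounded_field_constant, of s "inverse d" \<theta>] y
      by (simp add: f_eq divide_inverse evolve_cmult evolve_const mult.commute)
    have GU': "bounded_field (borel_on E) (\<lambda>r. evolve P r (\<lambda>y. k (s - r) * ?g y + c * (k (s - r) * k (s - r)) * \<phi> y))"
      by (rule bounded_field_evolve[OF bounded_field_comp[OF GU_field, of "\<lambda>r. s - r"]]) simp
    have Gu': "bounded_field (borel_on E) (\<lambda>r. evolve P r (Gu (s - r)))"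
      by (rule bounded_field_evolve[OF bounded_field_comp[OF Gu_field]]) simp
    have "(LINT r:{0..s}|lborel. evolve P r (G (s - r)) y)
       = (LINT r:{0..s}|lborel. evolve P r (\<lambda>y. k (s - r) * ?g y + c * (k (s - r) * k (s - r)) * \<phi> y) y
           - evolve P r (Gu (s - r)) y)"
      unfolding G_def
      by (subst evolve_diff[OF y bounded_field_at[OF GU_field] bounded_field_at[OF Gu_field]]) simp
    also have "\<dots> = (LINT r:{0..s}|lborel. evolve P r (\<lambda>y. k (s - r) * ?g y + c * (k (s - r) * k (s - r)) * \<phi> y) y)
        - (LINT r:{0..s}|lborel. evolve P r (Gu (s - r)) y)"
      using bounded_field_set_integrable[OF GU'] bounded_field_set_integrable[OF Gu'] y
      by (intro set_integral_diff(2)) auto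
    also have "(LINT r:{0..s}|lborel. evolve P r (\<lambda>y. k (s - r) * ?g y + c * (k (s - r) * k (s - r)) * \<phi> y) y)
       = (LINT r:{0..s}|lborel. evolve P r (\<lambda>y. ?g y / (c * (s - r) + d) + c * \<phi> y / (c * (s - r) + d)\<^sup>2) y)"
    proof (rule set_lebesgue_integral_cong)
      show "\<forall>r. r \<in> {0..s} \<longrightarrow> evolve P r (\<lambda>y. k (s - r) * ?g y + c * (k (s - r) * k (s - r)) * \<phi> y) y
          = evolve P r (\<lambda>y. ?g y / (c * (s - r) + d) + c * \<phi> y / (c * (s - r) + d)\<^sup>2) y"
        by (auto simp: k_def divide_inverse power2_eq_square mult_ac)
    qed simp
    also have "\<dots> = evolve P s \<phi> y / d - \<phi> y / (c * s + d)"
      using mild_time_scaling[OF \<phi>_Dom y s(1) c(1) d(1)] by linarith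
    finally show ?thesis
      using u_mild[OF s y] s by (simp add: fs w_def k_def divide_inverse mult.commute)
  qed
  \<comment> \<open>\<open>B + A * (C * inverse d + N)\<close> bounds the difference quotient of
    \<open>\<psi>\<close> between the solution and the supersolution; the extra \<open>1\<close>
    makes \<open>K\<close> positive.\<close>
  define K where "K = B + A * (C * inverse d + N) + 1"
  have K: "0 < K" using A(1) B(1) C(1) N0 d(1) by (auto simp: K_def intro!: add_nonneg_pos add_nonneg_nonneg mult_nonneg_nonneg)
  have U: "0 < k s * \<phi> y" "k s * \<phi> y \<le> C * inverse d" if "y \<in> E" for s y
  proof -
    show "0 < k s * \<phi> y" using k_pos \<phi>_pos[OF that] by simp
    have "k s * \<phi> y \<le> inverse d * C"
      using k_pos[of s] k_le[of s] \<phi>_pos[OF that] C(2)[OF that] d(1) by (intro mult_mono) auto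
    then show "k s * \<phi> y \<le> C * inverse d" by (simp add: mult.commute)
  qed
  have source: "- (2 * K * max 0 (- w s y)) \<le> K * w s y - G s y"
    if s: "0 \<le> s" "s \<le> t" and y: "y \<in> E" for s y
  proof -
    let ?U = "k s * \<phi> y" and ?u = "u s y"
    let ?V = "\<beta> y + \<alpha> y * (?U + ?u)"
    have u0: "0 \<le> ?u" "?u \<le> N" using u_nonneg[OF s(1) y] N[OF s y] by auto
    \<comment> \<open>The supersolution property: the time-derivative term is at most
      \<open>\<alpha> y * (?U * ?U)\<close> because \<open>c \<le> \<alpha> y * \<phi> y\<close>,
      and the generator term is \<open>(\<beta> y - l) * ?U\<close>, at most
      \<open>\<beta> y * ?U\<close> because \<open>0 \<le> l\<close>. The source of
      \<open>?U\<close> is therefore at most \<open>\<psi>\<close> of \<open>?U\<close>.\<close>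
    have "c * (k s * k s) * \<phi> y \<le> (\<alpha> y * \<phi> y) * (k s * k s) * \<phi> y"
      using c(2)[OF y] \<phi>_pos[OF y] k_pos[of s] by (intro mult_right_mono) auto
    moreover have "0 \<le> l * ?U" using l U(1)[OF y, of s] by simp
    ultimately have "G s y \<le> \<beta> y * ?U + \<alpha> y * (?U * ?U) - (\<beta> y * ?u + \<alpha> y * (?u * ?u))"
      by (simp add: G_def Gu_def g[OF y] v[OF s] algebra_simps)
    \<comment> \<open>\<open>\<psi>\<close> is quadratic without constant term, so its increment
      from \<open>?u\<close> to \<open>?U\<close> factors as \<open>?V * (?U - ?u)\<close>.\<close>
    then have G_le: "G s y \<le> ?V * w s y"
      by (simp add: w_def algebra_simps)
    have "0 \<le> \<alpha> y * (?U + ?u)" "\<alpha> y * (?U + ?u) \<le> A * (C * inverse d + N)"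
      using \<alpha>(2)[OF y] A(2)[OF y] U[OF y, of s] u0 A(1) by (auto intro!: mult_mono)
    then have V: "\<bar>?V\<bar> \<le> K"
      using B(2)[OF y] unfolding K_def by linarith
    \<comment> \<open>Where \<open>w\<close> is negative, the bound on \<open>?V\<close> only gives
      \<open>G s y \<le> - K * w s y\<close>, so the source is at least
      \<open>2 * K * w s y\<close>. This is the origin of the factor 2 in the source
      condition.\<close>
    show ?thesis
    proof (cases "0 \<le> w s y")
      case True
      have "?V * w s y \<le> K * w s y" using V True by (intro mult_right_mono) auto
      then show ?thesis using G_le True by simp
    next
      case False
      have "?V * w s y \<le> (- K) * w s y" using V False by (intro mult_right_mono_neg) auto
      then show ?thesis using G_le False by simp
    qed
  qed
  have "0 \<le> w t x"
  proof (rule mild_nonneg[OF K f_field _ G_field w_mild N0 _ source t order.refl x])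
    show "0 \<le> f y" if "y \<in> E" for y
      using d(1) d(2)[OF that] by (simp add: f_def field_simps)
    show "- N \<le> w s y" if "0 \<le> s" "s \<le> t" "y \<in> E" for s y
      using N[OF that] U(1)[OF that(3), of s] unfolding w_def by linarith
  qed
  then show ?thesis using t by (simp add: w_def k_def divide_inverse mult.commute)
qed

end

section \<open>Extinction\<close>

lemma space_finite_measure_algebra:
  "space (finite_measure_algebra N) = {M. finite_measure M \<and> sets M = sets N}"
  by (auto simp: finite_measure_algebra_def space_Sup_eq_UN)

lemma measurable_emeasure_finite_measure_algebra:
  "A \<in> sets N \<Longrightarrow> (\<lambda>M. emeasure M A) \<in> borel_measurable (finite_measure_algebra N)"
  by (auto intro!: measurable_Sup1 measurable_vimage_algebra1 simp: finite_measure_algebra_def)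

lemma continuous_map_weak_topology_integral:
  assumes "f \<in> Cb E"
  shows "continuous_map (weak_topology E) euclidean (\<lambda>\<nu>. \<integral>x. f x \<partial>\<nu>)"
proof -
  let ?B = "{{\<nu> \<in> finite_measures E. (\<integral>x. f x \<partial>\<nu>) \<in> U} | f U. f \<in> Cb E \<and> open U}"
  \<comment> \<open>Taking the whole line for \<open>U\<close> shows that the generating sets cover
    all of \<open>finite_measures E\<close>.\<close>
  have "{\<nu> \<in> finite_measures E. (\<integral>x. f x \<partial>\<nu>) \<in> UNIV} \<in> ?B" using assms by blast
  then have top: "topspace (weak_topology E) = finite_measures E"
    unfolding weak_topology_def topology_generated_by_topspace by auto
  show ?thesis
    unfolding continuous_map_def top
  proof (intro conjI allI impI)
    fix U :: "real set" assume "openin euclidean U"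
    then have "{\<nu> \<in> finite_measures E. (\<integral>x. f x \<partial>\<nu>) \<in> U} \<in> ?B" using assms by auto
    then show "openin (weak_topology E) {\<nu> \<in> finite_measures E. (\<integral>x. f x \<partial>\<nu>) \<in> U}"
      unfolding weak_topology_def by (rule topology_generated_by_Basis)
  qed simp
qed

lemma integral_const_finite_measures:
  "\<nu> \<in> finite_measures E \<Longrightarrow> (\<integral>x. (c::real) \<partial>\<nu>) = c * measure \<nu> E"
  using sets_eq_imp_space_eq[of \<nu> "borel_on E"] by (simp add: finite_measures_def space_restrict_space)

text \<open>The constant function 1 is a bounded continuous test function, so weak continuity of the
  path controls its total mass.\<close>

lemma continuous_total_mass:
  assumes X: "X \<in> continuous_measure_paths E" and fm: "\<And>t. 0 \<le> t \<Longrightarrow> X t \<in> finite_measures E"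
  shows "continuous_on {0..} (\<lambda>t. measure (X t) E)"
proof -
  have one: "(\<lambda>_. 1) \<in> Cb E" by (auto simp: Cb_def bounded_real)
  have "continuous_map (top_of_set {0..}) (weak_topology E) X"
    using X by (simp add: continuous_measure_paths_def)
  from continuous_map_compose[OF this continuous_map_weak_topology_integral[OF one]]
  have "continuous_on {0..} (\<lambda>t. \<integral>x. (1::real) \<partial>X t)"
    unfolding o_def continuous_map_iff_continuous .
  then show ?thesis
    by (rule continuous_on_eq) (use integral_const_finite_measures[OF fm, where c=1] in auto)
qed

lemma null_measure_iff_mass:
  assumes "\<nu> \<in> finite_measures E"
  shows "\<nu> = null_measure (borel_on E) \<longleftrightarrow> measure \<nu> E = 0"
proof
  assume mass: "measure \<nu> E = 0"
  interpret finite_measure \<nu> using assms by (simp add: finite_measures_def)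
  have sets: "sets \<nu> = sets (borel_on E)" using assms by (simp add: finite_measures_def)
  then have "space \<nu> = E" by (metis sets_eq_imp_space_eq space_borel_on)
  then have "emeasure \<nu> A = 0" for A
    using mass emeasure_space[of \<nu> A] by (simp add: emeasure_eq_measure)
  then show "\<nu> = null_measure (borel_on E)"
    using sets by (intro measure_eqI) auto
qed (simp add: measure_def)

lemma H_max_finite_iff: "H_max E X < \<infinity> \<longleftrightarrow> (\<exists>t>0. X t = null_measure (borel_on E))"
  unfolding H_max_def Inf_less_iff by auto

text \<open>Replaces an uncountable union over times by countable operations. On a compact interval
  the continuous \<open>m\<close> attains its minimum, which is 0 exactly when the values at
  rationals become arbitrarily small. The left endpoints stay positive so that the minimiser is a
  positive time.\<close>

lemma zero_iff_rational_small:
  fixes m :: "real \<Rightarrow> real"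
  assumes cont: "continuous_on {0..} m" and nonneg: "\<And>t. 0 \<le> t \<Longrightarrow> 0 \<le> m t"
  shows "(\<exists>t>0. m t = 0) \<longleftrightarrow>
    (\<exists>n. \<forall>k. \<exists>q\<in>\<rat> \<inter> {inverse (real (Suc n))..real (Suc n)}. m q < inverse (real (Suc k)))"
    (is "_ \<longleftrightarrow> ?R")
proof
  assume "\<exists>t>0. m t = 0"
  then obtain t where t: "0 < t" "m t = 0" by blast
  obtain n1 where n1: "inverse (real (Suc n1)) < t" using reals_Archimedean[OF t(1)] by blast
  obtain n2 where n2: "t < real n2" using reals_Archimedean2 by blast
  \<comment> \<open>The maximum places \<open>t\<close> strictly below the right endpoint, which
    leaves room for rationals just after \<open>t\<close>.\<close>
  define n where "n = max n1 n2"
  have n: "inverse (real (Suc n)) < t" "t < real (Suc n)"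
  proof -
    have "inverse (real (Suc n)) \<le> inverse (real (Suc n1))" by (intro le_imp_inverse_le) (auto simp: n_def)
    with n1 show "inverse (real (Suc n)) < t" by linarith
    show "t < real (Suc n)" using n2 by (auto simp: n_def)
  qed
  show ?R
  proof (intro exI allI)
    fix k
    have "isCont m t"
      using continuous_on_interior[OF cont, of t] t(1) by (simp add: interior_Ici[of "-1"])
    then obtain \<delta> where \<delta>: "0 < \<delta>" "\<And>s. dist s t < \<delta> \<Longrightarrow> dist (m s) (m t) < inverse (real (Suc k))"
      unfolding continuous_at_eps_delta by (metis inverse_positive_iff_positive of_nat_0_less_iff zero_less_Suc)
    have "t < min (t + \<delta>) (real (Suc n))" using \<delta>(1) n by simp
    then obtain q where q: "q \<in> \<rat>" "t < q" "q < min (t + \<delta>) (real (Suc n))"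
      using Rats_dense_in_real by blast
    have "m q < inverse (real (Suc k))"
      using \<delta>(2)[of q] q t(2) by (simp add: dist_real_def)
    then show "\<exists>q\<in>\<rat> \<inter> {inverse (real (Suc n))..real (Suc n)}. m q < inverse (real (Suc k))"
      using q n by (intro bexI[of _ q]) auto
  qed
next
  assume ?R
  then obtain n where n: "\<And>k. \<exists>q\<in>{inverse (real (Suc n))..real (Suc n)}. m q < inverse (real (Suc k))"
    by blast
  have pos: "0 < inverse (real (Suc n))" by simp
  let ?I = "{inverse (real (Suc n))..real (Suc n)}"
  have "?I \<noteq> {}" using n[of 0] by blast
  moreover have "continuous_on ?I m" using pos by (intro continuous_on_subset[OF cont]) auto
  ultimately obtain s where s: "s \<in> ?I" "\<And>q. q \<in> ?I \<Longrightarrow> m s \<le> m q"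
    using continuous_attains_inf[of ?I m] by auto
  have s_pos: "0 < s" using s(1) pos by (meson atLeastAtMost_iff less_le_trans)
  have "m s < inverse (real (Suc k))" for k
    using n[of k] s(2) by (meson le_less_trans)
  then have "m s \<le> 0" using reals_Archimedean[of "m s"] by (meson not_le order.asym)
  then show "\<exists>t>0. m t = 0" using s_pos nonneg[of s] by (intro exI[of _ s]) auto
qed

section \<open>Extinction probabilities of the superprocess\<close>

context
  fixes E :: "'a::topological_space set" and P \<beta> \<alpha> \<P>
  assumes superprocess: "superprocess E P \<beta> \<alpha> \<P>"
begin

abbreviation (input) "\<S> \<equiv> finite_measure_algebra (borel_on E)"
abbreviation (input) "\<W> \<equiv> path_algebra (finite_measure_algebra (borel_on E)) (continuous_measure_paths E)"

lemma
  assumes "\<nu> \<in> finite_measures E"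
  shows prob_space_superprocess: "prob_space (\<P> \<nu>)" and sets_superprocess: "sets (\<P> \<nu>) = sets \<W>"
proof -
  have "\<P> \<in> \<S> \<rightarrow>\<^sub>M prob_algebra \<W>"
    using superprocess unfolding superprocess_def markov_family_def by (elim conjE)
  moreover have "\<nu> \<in> space \<S>"
    using assms by (simp add: space_finite_measure_algebra finite_measures_def)
  ultimately have "\<P> \<nu> \<in> space (prob_algebra \<W>)" by (rule measurable_space)
  then show "prob_space (\<P> \<nu>)" "sets (\<P> \<nu>) = sets \<W>" unfolding space_prob_algebra by auto
qed

lemma superprocess_paths:
  assumes "\<nu> \<in> finite_measures E" and X: "X \<in> space (\<P> \<nu>)"
  shows "X \<in> continuous_measure_paths E" and "0 \<le> t \<Longrightarrow> X t \<in> finite_measures E"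
proof -
  have "X \<in> space \<W>" using X sets_eq_imp_space_eq[OF sets_superprocess[OF assms(1)]] by simp
  then have X': "X \<in> continuous_measure_paths E" "X \<in> {0..} \<rightarrow>\<^sub>E space \<S>"
    unfolding space_path_algebra by auto
  show "X \<in> continuous_measure_paths E" by fact
  show "X t \<in> finite_measures E" if "0 \<le> t"
    using PiE_mem[OF X'(2), of t] that by (simp add: space_finite_measure_algebra finite_measures_def)
qed

lemma measurable_total_mass:
  assumes "\<nu> \<in> finite_measures E" "0 \<le> t"
  shows "(\<lambda>X. measure (X t) E) \<in> borel_measurable (\<P> \<nu>)"
proof -
  have "E \<in> sets (borel_on E)" by (metis sets.top space_borel_on)
  from measurable_compose[OF measurable_path_eval[OF assms(2)] measurable_emeasure_finite_measure_algebra[OF this]]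
  have "(\<lambda>X. emeasure (X t) E) \<in> borel_measurable \<W>" .
  then have "(\<lambda>X. enn2real (emeasure (X t) E)) \<in> borel_measurable \<W>" by (rule measurable_compose) simp
  then show ?thesis
    unfolding measure_def by (subst measurable_cong_sets[OF sets_superprocess[OF assms(1)] refl])
qed

text \<open>Measurability carries weight here: \<open>measure\<close> is 0 on a set outside the
  sigma-algebra, so a lower bound can be passed on by monotonicity only to an event.\<close>

lemma H_max_event:
  assumes \<nu>: "\<nu> \<in> finite_measures E"
  shows "{X \<in> space (\<P> \<nu>). H_max E X < \<infinity>} \<in> sets (\<P> \<nu>)"
    and "{X \<in> space (\<P> \<nu>). H_max E X < \<infinity>} = {X \<in> space (\<P> \<nu>). \<exists>t>0. measure (X t) E = 0}"
proof -
  let ?Q = "\<lambda>n. \<rat> \<inter> {inverse (real (Suc n))..real (Suc n)}"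
  have "(\<exists>t>0. X t = null_measure (borel_on E)) \<longleftrightarrow> (\<exists>t>0. measure (X t) E = 0)"
    if "X \<in> space (\<P> \<nu>)" for X
    using null_measure_iff_mass[OF superprocess_paths(2)[OF \<nu> that]] by (meson less_imp_le)
  then show eq: "{X \<in> space (\<P> \<nu>). H_max E X < \<infinity>} = {X \<in> space (\<P> \<nu>). \<exists>t>0. measure (X t) E = 0}"
    unfolding H_max_finite_iff by blast
  also have "\<dots> = {X \<in> space (\<P> \<nu>). \<exists>n. \<forall>k. \<exists>q\<in>?Q n. measure (X q) E < inverse (real (Suc k))}"
  proof (rule Collect_cong, rule conj_cong[OF refl])
    fix X assume X: "X \<in> space (\<P> \<nu>)"
    show "(\<exists>t>0. measure (X t) E = 0) \<longleftrightarrow> (\<exists>n. \<forall>k. \<exists>q\<in>?Q n. measure (X q) E < inverse (real (Suc k)))"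
      by (rule zero_iff_rational_small[OF continuous_total_mass[OF superprocess_paths[OF \<nu> X]]]) auto
  qed
  also have "\<dots> = (\<Union>n. \<Inter>k. \<Union>q\<in>?Q n. {X \<in> space (\<P> \<nu>). measure (X q) E < inverse (real (Suc k))})"
    by (simp only: set_eq_iff mem_Collect_eq UN_iff INT_iff) blast
  also have "\<dots> \<in> sets (\<P> \<nu>)"
  proof (intro sets.countable_UN'' sets.countable_INT' countableI_type image_subsetI)
    fix n k q assume q: "q \<in> ?Q n"
    have "0 < inverse (real (Suc n))" by simp
    then have "0 \<le> q" using q by (meson IntD2 atLeastAtMost_iff less_imp_le order_trans)
    from measurable_total_mass[OF \<nu> this]
    show "{X \<in> space (\<P> \<nu>). measure (X q) E < inverse (real (Suc k))} \<in> sets (\<P> \<nu>)"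
      by (rule borel_measurable_less) simp
  qed (auto intro: countable_Int1 countable_rat)
  finally show "{X \<in> space (\<P> \<nu>). H_max E X < \<infinity>} \<in> sets (\<P> \<nu>)" .
qed

text \<open>With a constant test function and no occupation term, the Laplace functional of the
  process becomes the Laplace transform of its total mass.\<close>

lemma Laplace_total_mass:
  assumes \<theta>: "0 \<le> \<theta>"
  obtains u where "cumulant_solution E P \<beta> \<alpha> (\<lambda>_. \<theta>) (\<lambda>_. 0) u"
    and "\<And>\<nu> t. \<nu> \<in> finite_measures E \<Longrightarrow> 0 \<le> t \<Longrightarrow>
      (\<integral>X. exp (- (\<theta> * measure (X t) E)) \<partial>\<P> \<nu>) = exp (- (\<integral>x. u t x \<partial>\<nu>))"
proof -
  have "(\<lambda>_. c) \<in> bounded_nonneg_measurable E" if "0 \<le> c" for c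
    using that by (auto simp: bounded_nonneg_measurable_def bounded_real)
  from superprocess[unfolded superprocess_def, THEN conjunct2, rule_format, OF this[OF \<theta>] this[OF order.refl]]
  obtain u where u: "cumulant_solution E P \<beta> \<alpha> (\<lambda>_. \<theta>) (\<lambda>_. 0) u"
    and Laplace: "\<forall>\<nu>\<in>finite_measures E. \<forall>t\<ge>0.
      (\<integral>X. exp (- (\<integral>x. \<theta> \<partial>X t) - (LINT s:{0..t}|lborel. (\<integral>x. 0 \<partial>X s))) \<partial>\<P> \<nu>) = exp (- (\<integral>x. u t x \<partial>\<nu>))"
    by (elim exE conjE) (rule that; assumption)
  have "(\<integral>X. exp (- (\<theta> * measure (X t) E)) \<partial>\<P> \<nu>) = exp (- (\<integral>x. u t x \<partial>\<nu>))"
    if \<nu>: "\<nu> \<in> finite_measures E" and t: "0 \<le> t" for \<nu> t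
  proof -
    have "(\<integral>X. exp (- (\<theta> * measure (X t) E)) \<partial>\<P> \<nu>)
        = (\<integral>X. exp (- (\<integral>x. \<theta> \<partial>X t) - (LINT s:{0..t}|lborel. (\<integral>x. 0 \<partial>X s))) \<partial>\<P> \<nu>)"
      by (intro Bochner_Integration.integral_cong refl)
        (subst integral_const_finite_measures[OF superprocess_paths(2)[OF \<nu> _ t]], simp, simp add: set_lebesgue_integral_def)
    then show ?thesis using Laplace[rule_format, OF \<nu> t] by simp
  qed
  with u show thesis by (rule that)
qed

text \<open>As the parameter tends to infinity, exp(- \<open>\<theta>\<close> m) converges to the
  indicator of m = 0 and stays below 1. Since \<open>b\<close> is uniform in
  \<open>\<theta>\<close>, the lower bound on the Laplace transforms survives in the limit.\<close>

lemma measure_mass_zero_ge: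
  assumes \<nu>: "\<nu> \<in> finite_measures E" and t: "0 < t"
    and le: "\<And>\<theta> u x. 0 < \<theta> \<Longrightarrow> cumulant_solution E P \<beta> \<alpha> (\<lambda>_. \<theta>) (\<lambda>_. 0) u \<Longrightarrow> x \<in> E \<Longrightarrow> u t x \<le> b"
    and b: "0 \<le> b"
  shows "exp (- (b * measure \<nu> E)) \<le> measure (\<P> \<nu>) {X \<in> space (\<P> \<nu>). measure (X t) E = 0}"
proof -
  interpret prob_space "\<P> \<nu>" by (rule prob_space_superprocess[OF \<nu>])
  let ?A = "{X \<in> space (\<P> \<nu>). measure (X t) E = 0}"
  note [measurable] = measurable_total_mass[OF \<nu> less_imp_le[OF t]]
  have \<nu>_space: "space \<nu> = E"
    using \<nu> sets_eq_imp_space_eq[of \<nu> "borel_on E"] by (simp add: finite_measures_def)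
  have lower: "exp (- (b * measure \<nu> E)) \<le> (\<integral>X. exp (- (real (Suc n) * measure (X t) E)) \<partial>\<P> \<nu>)" for n
  proof -
    have "0 \<le> real (Suc n)" by simp
    then obtain u where u: "cumulant_solution E P \<beta> \<alpha> (\<lambda>_. real (Suc n)) (\<lambda>_. 0) u"
      and Laplace: "\<And>\<nu> t. \<nu> \<in> finite_measures E \<Longrightarrow> 0 \<le> t \<Longrightarrow>
        (\<integral>X. exp (- (real (Suc n) * measure (X t) E)) \<partial>\<P> \<nu>) = exp (- (\<integral>x. u t x \<partial>\<nu>))"
      by (rule Laplace_total_mass) blast
    have "(\<integral>x. u t x \<partial>\<nu>) \<le> (\<integral>x. b \<partial>\<nu>)"
    \<comment> \<open>This form asks integrability only of the constant; \<open>0 \<le> b\<close>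
      covers the convention that a non-integrable \<open>u t\<close> has integral 0.\<close>
    proof (rule integral_mono')
      show "integrable \<nu> (\<lambda>x. b)"
        using \<nu> by (simp add: finite_measures_def finite_measure.integrable_const)
    qed (use le[OF _ u] b \<nu>_space in auto)
    also have "\<dots> = b * measure \<nu> E" by (rule integral_const_finite_measures[OF \<nu>])
    finally show ?thesis using Laplace[OF \<nu>] t by simp
  qed
  have "(\<lambda>n. \<integral>X. exp (- (real (Suc n) * measure (X t) E)) \<partial>\<P> \<nu>) \<longlonglongrightarrow> (\<integral>X. indicator ?A X \<partial>\<P> \<nu>)"
  proof (rule integral_dominated_convergence[where w="\<lambda>_. 1"])
    show "AE X in \<P> \<nu>. (\<lambda>n. exp (- (real (Suc n) * measure (X t) E))) \<longlonglongrightarrow> indicator ?A X"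
    proof (rule AE_I2)
      fix X assume X: "X \<in> space (\<P> \<nu>)"
      show "(\<lambda>n. exp (- (real (Suc n) * measure (X t) E))) \<longlonglongrightarrow> indicator ?A X"
      proof (cases "measure (X t) E = 0")
        case False
        then have "exp (- measure (X t) E) < 1" by (simp add: zero_less_measure_iff)
        then have "(\<lambda>n. exp (- measure (X t) E) ^ Suc n) \<longlonglongrightarrow> 0"
          by (intro LIMSEQ_Suc LIMSEQ_realpow_zero) auto
        then show ?thesis
          using False by (simp add: exp_of_nat_mult[symmetric] del: of_nat_Suc power_Suc)
      qed (use X in simp)
    qed
  qed (auto intro!: AE_I2)
  then have "exp (- (b * measure \<nu> E)) \<le> (\<integral>X. indicator ?A X \<partial>\<P> \<nu>)"
    using lower by (intro LIMSEQ_le_const) auto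
  then show ?thesis by simp
qed

text \<open>Zero mass at any one positive time already makes \<open>H_max\<close> finite, so its
  probability inherits the lower bound for every \<open>t\<close>. The decay of \<open>b / t\<close>
  pushes this bound to 1.\<close>

lemma global_extinctionI:
  assumes le: "\<And>\<theta> u t x. 0 < \<theta> \<Longrightarrow> cumulant_solution E P \<beta> \<alpha> (\<lambda>_. \<theta>) (\<lambda>_. 0) u \<Longrightarrow>
      0 < t \<Longrightarrow> x \<in> E \<Longrightarrow> u t x \<le> b / t"
    and b: "0 \<le> b"
  shows "global_extinction E \<P>"
  unfolding global_extinction_def
proof
  fix \<nu> assume \<nu>: "\<nu> \<in> finite_measures E"
  interpret prob_space "\<P> \<nu>" by (rule prob_space_superprocess[OF \<nu>])
  let ?H = "{X \<in> space (\<P> \<nu>). H_max E X < \<infinity>}"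
  have lower: "exp (- (b / real (Suc n) * measure \<nu> E)) \<le> prob ?H" for n
  proof -
    have "exp (- (b / real (Suc n) * measure \<nu> E)) \<le> prob {X \<in> space (\<P> \<nu>). measure (X (real (Suc n))) E = 0}"
      using le b by (intro measure_mass_zero_ge[OF \<nu>]) auto
    also have "\<dots> \<le> prob ?H"
      using H_max_event(1)[OF \<nu>] unfolding H_max_event(2)[OF \<nu>]
      by (intro finite_measure_mono) (auto intro!: exI[of _ "real (Suc n)"])
    finally show ?thesis .
  qed
  have "(\<lambda>n. exp (- (b * inverse (real (Suc n)) * measure \<nu> E))) \<longlonglongrightarrow> exp (- (b * 0 * measure \<nu> E))"
    by (intro tendsto_intros LIMSEQ_inverse_real_of_nat)
  then have "exp (- (b * 0 * measure \<nu> E)) \<le> prob ?H"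
    using lower by (intro LIMSEQ_le_const2) (auto simp: divide_inverse)
  then have "1 \<le> prob ?H" by simp
  then show "prob ?H = 1" by (intro antisym prob_le_1)
qed

end

theorem lemma6p2:
  fixes E :: "(real^'k::finite) set"
    and P :: "real^'k \<Rightarrow> (real \<Rightarrow> real^'k) measure"
    and \<P> :: "(real^'k) measure \<Rightarrow> (real \<Rightarrow> (real^'k) measure) measure"
    and \<alpha> \<beta> \<phi>\<^sub>0 :: "real^'k \<Rightarrow> real"
    and lam\<^sub>0 C\<^sub>1 C\<^sub>2 :: real
  assumes motion: "strong_markov_family (borel_on E) (cadlag_paths E) P"
    and semigroup: "Cb_semigroup E P"
    and cases: "irreducible_finite_chain E P \<or> (\<exists>\<mu> a b. diffusion E P \<mu> a b)"
    and beta: "\<beta> \<in> Cb E"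
    and alpha: "\<alpha> \<in> Cb E" "\<exists>c>0. \<forall>x\<in>E. c \<le> \<alpha> x"
    and superprocess: "superprocess E P \<beta> \<alpha> \<P>"
    and eigenvalue: "ereal lam\<^sub>0 = generalized_eigenvalue E P \<beta>"
    and harmonic: "\<phi>\<^sub>0 \<in> positive_harmonic E P \<beta> lam\<^sub>0"
    and one_dimensional: "\<forall>u\<in>positive_harmonic E P \<beta> lam\<^sub>0. \<exists>c. \<forall>x\<in>E. u x = c * \<phi>\<^sub>0 x"
    and nonneg: "lam\<^sub>0 \<ge> 0"
    and inverse_alpha: "(\<lambda>x. 1 / \<alpha> x) \<in> Dom E P"
    and phi0_Dom: "\<phi>\<^sub>0 \<in> Dom E P"
    and bounds: "C\<^sub>1 > 0" "C\<^sub>2 > 0" "\<forall>x\<in>E. C\<^sub>1 \<le> \<phi>\<^sub>0 x \<and> \<phi>\<^sub>0 x \<le> C\<^sub>2"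
  shows "global_extinction E \<P>"
proof -
  interpret cadlag_markov E P
    using motion unfolding strong_markov_family_def by unfold_locales (elim conjE)
  obtain a where a: "0 < a" "\<And>x. x \<in> E \<Longrightarrow> a \<le> \<alpha> x" using alpha(2) by blast
  \<comment> \<open>The product of the lower bounds of \<open>\<alpha>\<close> and
    \<open>\<phi>\<^sub>0\<close>: the constant must lie below
    \<open>\<alpha> x * \<phi>\<^sub>0 x\<close> for the supersolution property.\<close>
  define c where "c = a * C\<^sub>1"
  have c: "0 < c" using a(1) bounds(1) by (simp add: c_def)
  have c_le: "c \<le> \<alpha> x * \<phi>\<^sub>0 x" if "x \<in> E" for x
    unfolding c_def using a(2)[OF that] order.trans[OF less_imp_le[OF a(1)] a(2)[OF that]] bounds that
    by (intro mult_mono) auto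
  show ?thesis
  proof (rule global_extinctionI[OF superprocess])
    fix \<theta> t :: real and u x
    assume \<theta>: "0 < \<theta>" and u: "cumulant_solution E P \<beta> \<alpha> (\<lambda>_. \<theta>) (\<lambda>_. 0) u"
      and t: "0 < t" and x: "x \<in> E"
    \<comment> \<open>The choice \<open>C\<^sub>1 / \<theta>\<close> is the largest \<open>d\<close>
      for which the lower bound \<open>C\<^sub>1\<close> alone guarantees
      \<open>d * \<theta> \<le> \<phi>\<^sub>0 y\<close>, that is, an initial value of at least
      \<open>\<theta>\<close>.\<close>
    have "u t x \<le> \<phi>\<^sub>0 x / (c * t + C\<^sub>1 / \<theta>)"
    proof (rule cumulant_solution_le[OF u beta alpha(1) _ harmonic nonneg _ c_le _ _ _ x])
      show "0 \<le> \<alpha> y" if "y \<in> E" for y using a(1) a(2)[OF that] by linarith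
      show "C\<^sub>1 / \<theta> * \<theta> \<le> \<phi>\<^sub>0 y" if "y \<in> E" for y using \<theta> bounds(3) that by simp
    qed (use c bounds(1) \<theta> t in auto)
    \<comment> \<open>Dropping the positive term \<open>C\<^sub>1 / \<theta>\<close> from the
      denominator removes the only dependence on \<open>\<theta>\<close>.\<close>
    also have "\<dots> \<le> C\<^sub>2 / (c * t)"
      using bounds x c t \<theta> by (intro frac_le) auto
    finally show "u t x \<le> C\<^sub>2 / c / t" by (simp add: mult.commute)
  qed (use bounds(2) c in simp)
qed

end
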